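(* In the market model described in the context, suppose $H$ is a pricing rule satisfying $$H_t+\tfrac12\sigma^2H_{yy}=0.$$ If $X_t=\int_0^t\alpha_s\,ds$ for some $\mathcal{F}^I$-progressively measurable $\alpha$ such that, for all $v\in f(\mathbb{R})$, we have $\mathbb{P}^v\big(\int_0^1|\alpha_s|\,ds<\infty\big)=1$, $$\mathbb{E}^v\Big(\int_0^1H^2(t,X_t+\sigma B_t)\,dt\Big)<\infty$$ and $$H(1,X_1+\sigma B_1)=V,\qquad\mathbb{P}^v\text{-a.s.},$$ then $X\in\mathcal{A}(H)$ and it is an optimal strategy for the insider, i.e. $\mathbb{E}^v[W^X_1]=\sup_{\tilde X\in\mathcal{A}(H)}\mathbb{E}^v[W^{\tilde X}_1]$ for all $v\in f(\mathbb{R})$.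
   Context: Setting. $\sigma>0$ is a constant. $(\Omega,\mathcal{F},(\mathcal{F}_t)_{t\in[0,1]},\mathbb{P})$ is a filtered probability space satisfying the usual conditions, supporting an $\mathcal{F}_0$-measurable standard normal random variable $\eta$ and a standard $(\mathcal{F}_t)$-Brownian motion $B$ with $B_0=0$ (so $B$ is independent of $\eta$). $V:=f(\eta)$ where $f:\mathbb{R}\to\mathbb{R}$ is bounded, strictly increasing and has a continuous derivative. $\mathcal{F}$ is the completion of the $\sigma$-field generated by $V$ and $(B_t)_{t\in[0,1]}$. $(\mathbb{P}^v)_{v\in f(\mathbb{R})}$ is the family of probability measures with $\mathbb{P}^v(E)=\mathbb{P}(E\mid V=v)$ and $\mathbb{P}(E)=\int_{f(\mathbb{R})}\mathbb{P}^v(E)\,\mathbb{P}(V\in dv)$ for all $E\in\mathcal{F}$ (which can be realised on $f(\mathbb{R})\times C([0,1],\mathbb{R})$, so that under $\mathbb{P}^v$ one has $V=v$ a.s. and $B$ is a Brownian motion); $\mathbb{E}^v$ is expectation under $\mathbb{P}^v$. Filtration. For an insider strategy $X$ and pricing rule $H$, write $Y=X+\sigma B$ (total demand). Under $\mathbb{P}^v$, $\mathcal{F}^I$ is the minimal right-continuous filtration generated by $V$ and the price process $H(t,Y_t)$, completed with the null sets of $\mathbb{P}^v$. Pricing rule. A function $H:\mathbb{R}_+\times\mathbb{R}\to\mathbb{R}$ is a pricing rule if $H\in C^{1,2}$, $H$ is strictly increasing in $y$ (its second argument), and $\mathbb{E}H^2(1,\sigma B_1)<\infty$ and $\mathbb{E}\int_0^1H^2(t,\sigma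 B_t)\,dt<\infty$. Admissible strategies. For a pricing rule $H$, $X\in\mathcal{A}(H)$ iff $X_t=\int_0^t\alpha_s\,ds$ for some $\mathcal{F}^I$-progressively measurable $\alpha$ such that for all $v\in f(\mathbb{R})$: $\mathbb{P}^v(\int_0^1|\alpha_s|\,ds<\infty)=1$, $\mathbb{E}^v\int_0^1H^2(t,X_t+\sigma B_t)\,dt<\infty$, and $\mathbb{E}^v[\min\{0,W^X_1\}]>-\infty$, where $W^X_1=\int_0^1X_s\,dH(s,Y_s)+X_1(V-H(1,Y_1))=\int_0^1(V-H(s,Y_s))\,dX_s$, with $Y=X+\sigma B$, is the insider's terminal wealth.
   Formalization: Insider strategies X (the given one and all competitors in A(H)) are also required to be adapted to the augmented filtration generated by V and B; with F^I-progressive α alone, X may anticipate B (e.g. X_t=t^{1/4}B_1 near 0) and the supremum can be infinite. *)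

theory Defs
  imports "HOL-Probability.Probability"
begin

section \<open>Filtrations on the time interval [0,1] and Brownian motion\<close>

text \<open>Time is a real number; only the times in \<open>{0..1}\<close> matter for filtrations and processes.\<close>

definition generated_filtration ::
  "'a set \<Rightarrow> ('a \<Rightarrow> real) \<Rightarrow> (real \<Rightarrow> 'a \<Rightarrow> real) \<Rightarrow> real \<Rightarrow> 'a measure" where
  "generated_filtration \<Omega> V Z t = sigma \<Omega>
     ({V -` A \<inter> \<Omega> | A. A \<in> sets borel} \<union> {Z s -` A \<inter> \<Omega> | s A. s \<in> {0..t} \<and> A \<in> sets borel})"

definition right_limit :: "(real \<Rightarrow> 'a measure) \<Rightarrow> real \<Rightarrow> 'a set set" where
  "right_limit F t = (if t < 1 then (\<Inter>s\<in>{t<..1}. sets (F s)) else sets (F t))"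

definition augmentation :: "'a measure \<Rightarrow> (real \<Rightarrow> 'a measure) \<Rightarrow> real \<Rightarrow> 'a measure" where
  "augmentation M F t = sigma (space M) (right_limit F t \<union> null_sets (completion M))"

definition usual_conditions :: "'a measure \<Rightarrow> (real \<Rightarrow> 'a measure) \<Rightarrow> bool" where
  "usual_conditions M F \<longleftrightarrow>
     complete_measure M \<and>
     (\<forall>t\<in>{0..1}. subalgebra M (F t)) \<and>
     (\<forall>s\<in>{0..1}. \<forall>t\<in>{0..1}. s \<le> t \<longrightarrow> sets (F s) \<subseteq> sets (F t)) \<and>
     (\<forall>t\<in>{0..1}. sets (F t) = right_limit F t) \<and>
     null_sets M \<subseteq> sets (F 0)"

definition progressively_measurable ::
  "(real \<Rightarrow> 'a measure) \<Rightarrow> (real \<Rightarrow> 'a \<Rightarrow> real) \<Rightarrow> bool" where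
  "progressively_measurable F a \<longleftrightarrow>
     (\<forall>t\<in>{0..1}. (\<lambda>(s, \<omega>). a s \<omega>) \<in> borel_measurable (restrict_space borel {0..t} \<Otimes>\<^sub>M F t))"

definition brownian_motion ::
  "'a measure \<Rightarrow> (real \<Rightarrow> 'a measure) \<Rightarrow> (real \<Rightarrow> 'a \<Rightarrow> real) \<Rightarrow> bool" where
  "brownian_motion M F B \<longleftrightarrow>
     prob_space M \<and>
     (\<forall>t\<in>{0..1}. B t \<in> borel_measurable (F t)) \<and>
     (AE \<omega> in M. B 0 \<omega> = 0 \<and> continuous_on {0..1} (\<lambda>t. B t \<omega>)) \<and>
     (\<forall>s t. 0 \<le> s \<and> s < t \<and> t \<le> 1 \<longrightarrow>
        distributed M lborel (\<lambda>\<omega>. B t \<omega> - B s \<omega>) (normal_density 0 (sqrt (t - s))) \<and>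
        prob_space.indep_set M (sets (F s))
          (sets (vimage_algebra (space M) (\<lambda>\<omega>. B t \<omega> - B s \<omega>) borel)))"


section \<open>The market model\<close>

text \<open>
  The \<sigma>-field of \<open>P\<close> contains every subset of every \<open>P\<close>-null event \<open>V = v\<close>, and a probability
  measure concentrated on \<open>V = v\<close> under which \<open>B\<close> is a Brownian motion cannot be expected to
  measure all of these. The conditional laws \<open>Pv v\<close> therefore live on the uncompleted \<sigma>-field
  generated by \<open>V\<close> and \<open>B\<close>, and each of them is completed separately. The equation
  \<open>P E = (\<integral> Pv v E d(law of V))\<close> is the case \<open>A = UNIV\<close> of the last assumption below,
  which expresses \<open>Pv v E = P (E | V = v)\<close>.
\<close>

locale insider_market =
  fixes \<sigma> :: real and f :: "real \<Rightarrow> real"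
    and P :: "'a measure" and F :: "real \<Rightarrow> 'a measure"
    and \<eta> V :: "'a \<Rightarrow> real" and B :: "real \<Rightarrow> 'a \<Rightarrow> real"
    and Pv :: "real \<Rightarrow> 'a measure"
  assumes sigma_pos: "\<sigma> > 0"
    and prob_P: "prob_space P"
    and usual: "usual_conditions P F"
    and eta_measurable: "\<eta> \<in> borel_measurable (F 0)"
    and eta_normal: "distributed P lborel \<eta> std_normal_density"
    and brownian: "brownian_motion P F B"
    and f_bounded: "bounded (range f)"
    and f_strict_mono: "strict_mono f"
    and f_C1: "\<exists>f'. (\<forall>x. (f has_real_derivative f' x) (at x)) \<and> continuous_on UNIV f'"
    and V_eq: "V = (\<lambda>\<omega>. f (\<eta> \<omega>))"
    and P_completion:
      "P = completion (restr_to_subalg P (generated_filtration (space P) V B 1))"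
    and Pv_kernel:
      "Pv \<in> restrict_space borel (range f)
         \<rightarrow>\<^sub>M prob_algebra (generated_filtration (space P) V B 1)"
    and Pv_V: "\<forall>v\<in>range f. AE \<omega> in Pv v. V \<omega> = v"
    and Pv_brownian:
      "\<forall>v\<in>range f. brownian_motion (Pv v) (generated_filtration (space P) V B) B"
    and Pv_conditional:
      "\<forall>E \<in> sets (generated_filtration (space P) V B 1). \<forall>A \<in> sets borel.
         emeasure P (E \<inter> {\<omega> \<in> space P. V \<omega> \<in> A})
           = (\<integral>\<^sup>+v\<in>A \<inter> range f. emeasure (Pv v) E \<partial>distr P borel V)"


section \<open>Pricing rules\<close>

definition D_t :: "(real \<Rightarrow> real \<Rightarrow> real) \<Rightarrow> real \<Rightarrow> real \<Rightarrow> real" where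
  "D_t H t y = vector_derivative (\<lambda>s. H s y) (at t within {0..})"

definition D_y :: "(real \<Rightarrow> real \<Rightarrow> real) \<Rightarrow> real \<Rightarrow> real \<Rightarrow> real" where
  "D_y H t y = deriv (H t) y"

definition D_yy :: "(real \<Rightarrow> real \<Rightarrow> real) \<Rightarrow> real \<Rightarrow> real \<Rightarrow> real" where
  "D_yy H t y = deriv (D_y H t) y"

text \<open>\<open>H\<close> is only looked at for \<open>t \<ge> 0\<close>; at \<open>t = 0\<close> the time derivative is one-sided.\<close>

definition C12 :: "(real \<Rightarrow> real \<Rightarrow> real) \<Rightarrow> bool" where
  "C12 H \<longleftrightarrow>
     (\<forall>t\<ge>0. \<forall>y. (\<lambda>s. H s y) differentiable (at t within {0..}) \<and>
        H t differentiable (at y) \<and> D_y H t differentiable (at y)) \<and>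
     continuous_on ({0..} \<times> UNIV) (\<lambda>(t, y). H t y) \<and>
     continuous_on ({0..} \<times> UNIV) (\<lambda>(t, y). D_t H t y) \<and>
     continuous_on ({0..} \<times> UNIV) (\<lambda>(t, y). D_y H t y) \<and>
     continuous_on ({0..} \<times> UNIV) (\<lambda>(t, y). D_yy H t y)"

definition pricing_rule ::
  "real \<Rightarrow> 'a measure \<Rightarrow> (real \<Rightarrow> 'a \<Rightarrow> real) \<Rightarrow> (real \<Rightarrow> real \<Rightarrow> real) \<Rightarrow> bool" where
  "pricing_rule \<sigma> P B H \<longleftrightarrow>
     C12 H \<and> (\<forall>t\<ge>0. strict_mono (H t)) \<and>
     (\<integral>\<^sup>+\<omega>. ennreal ((H 1 (\<sigma> * B 1 \<omega>))\<^sup>2) \<partial>P) < \<infinity> \<and>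
     (\<integral>\<^sup>+\<omega>. (\<integral>\<^sup>+t\<in>{0..1}. ennreal ((H t (\<sigma> * B t \<omega>))\<^sup>2) \<partial>lborel) \<partial>P) < \<infinity>"


section \<open>Insider strategies\<close>

definition total_demand ::
  "real \<Rightarrow> (real \<Rightarrow> 'a \<Rightarrow> real) \<Rightarrow> (real \<Rightarrow> 'a \<Rightarrow> real) \<Rightarrow> real \<Rightarrow> 'a \<Rightarrow> real" where
  "total_demand \<sigma> B X t \<omega> = X t \<omega> + \<sigma> * B t \<omega>"

definition insider_filtration ::
  "'a measure \<Rightarrow> ('a \<Rightarrow> real) \<Rightarrow> (real \<Rightarrow> real \<Rightarrow> real) \<Rightarrow> (real \<Rightarrow> 'a \<Rightarrow> real)
     \<Rightarrow> real \<Rightarrow> 'a measure" where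
  "insider_filtration M V H Y =
     augmentation M (generated_filtration (space M) V (\<lambda>t \<omega>. H t (Y t \<omega>)))"

text \<open>
  The first clause says that \<open>X\<close> is a process on the filtered space of the model, that is, adapted
  to the filtration with respect to which \<open>B\<close> is a Brownian motion; under \<open>Pv v\<close> this is the
  augmentation of the filtration generated by \<open>V\<close> and \<open>B\<close>. Measurability of the trading rate
  with respect to the insider filtration does not imply it, because that filtration is generated
  by prices which depend on \<open>X\<close> itself: \<open>X\<^sub>t = t\<^bsup>1/4\<^esup> B\<^sub>1\<close> anticipates \<open>B\<close>, but
  \<open>B\<^sub>1 = lim t\<^bsup>-1/4\<^esup> (X\<^sub>t + \<sigma> B\<^sub>t)\<close> as \<open>t\<close> decreases to \<open>0\<close>.
\<close>

definition insider_strategy ::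
  "real \<Rightarrow> (real \<Rightarrow> real) \<Rightarrow> ('a \<Rightarrow> real) \<Rightarrow> (real \<Rightarrow> 'a \<Rightarrow> real) \<Rightarrow> (real \<Rightarrow> 'a measure)
     \<Rightarrow> (real \<Rightarrow> real \<Rightarrow> real) \<Rightarrow> (real \<Rightarrow> 'a \<Rightarrow> real) \<Rightarrow> bool" where
  "insider_strategy \<sigma> f V B Pv H X \<longleftrightarrow>
     (\<forall>v\<in>range f. \<forall>t\<in>{0..1}. X t \<in> borel_measurable
        (augmentation (Pv v) (generated_filtration (space (Pv v)) V B) t)) \<and>
     (\<exists>\<alpha>. \<forall>v\<in>range f.
        progressively_measurable (insider_filtration (Pv v) V H (total_demand \<sigma> B X)) \<alpha> \<and>
        (AE \<omega> in completion (Pv v). (\<integral>\<^sup>+s\<in>{0..1}. ennreal \<bar>\<alpha> s \<omega>\<bar> \<partial>lborel) < \<infinity>) \<and>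
        (AE \<omega> in completion (Pv v). \<forall>t\<in>{0..1}. X t \<omega> = (LINT s:{0..t}|lborel. \<alpha> s \<omega>)))"

definition square_integrable_price ::
  "real \<Rightarrow> (real \<Rightarrow> 'a \<Rightarrow> real) \<Rightarrow> 'a measure \<Rightarrow> (real \<Rightarrow> real \<Rightarrow> real)
     \<Rightarrow> (real \<Rightarrow> 'a \<Rightarrow> real) \<Rightarrow> bool" where
  "square_integrable_price \<sigma> B M H X \<longleftrightarrow>
     (\<integral>\<^sup>+\<omega>. (\<integral>\<^sup>+t\<in>{0..1}. ennreal ((H t (total_demand \<sigma> B X t \<omega>))\<^sup>2) \<partial>lborel)
        \<partial>completion M) < \<infinity>"


section \<open>Terminal wealth\<close>

text \<open>
  The integral of \<open>g\<close> against \<open>dx\<close> over \<open>[0,1]\<close> for a path \<open>x\<close> that is absolutely continuous on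
  \<open>[0,1]\<close>. The value does not depend on the chosen density, by lemma \<open>ac_integral_eq\<close> below.
\<close>

definition ac_density :: "(real \<Rightarrow> real) \<Rightarrow> (real \<Rightarrow> real) \<Rightarrow> bool" where
  "ac_density x a \<longleftrightarrow> set_integrable lborel {0..1} a \<and>
     (\<forall>t\<in>{0..1}. x t = x 0 + (LINT s:{0..t}|lborel. a s))"

definition ac_integral :: "(real \<Rightarrow> real) \<Rightarrow> (real \<Rightarrow> real) \<Rightarrow> real" where
  "ac_integral g x = (LINT s:{0..1}|lborel. g s * (SOME a. ac_density x a) s)"

lemma ac_density_unique:
  assumes a: "ac_density x a" and b: "ac_density x b"
  shows "AE s in lborel. s \<in> {0..1} \<longrightarrow> a s = b s"
proof -
  define u where "u = (\<lambda>s. indicator {0..1} s * a s :: real)"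
  define v where "v = (\<lambda>s. indicator {0..1} s * b s :: real)"
  have u: "integrable lborel u" and v: "integrable lborel v"
    using a b unfolding ac_density_def set_integrable_def u_def v_def real_scaleR_def by blast+
  then have [measurable]: "u \<in> borel_measurable borel" "v \<in> borel_measurable borel"
    by auto
  have upto: "(LINT s:{..t}|lborel. u s) = (LINT s:{..t}|lborel. v s)" for t
  proof (cases "t < 0")
    case True
    then have "indicator {..t} s * u s = 0" "indicator {..t} s * v s = 0" for s
      by (auto simp: u_def v_def indicator_def)
    then show ?thesis
      by (simp only: set_lebesgue_integral_def real_scaleR_def)
  next
    case False
    define r where "r = min t 1"
    have r: "r \<in> {0..1}"
      using False by (auto simp: r_def)
    have "indicator {..t} s * u s = indicator {0..r} s * a s"
      "indicator {..t} s * v s = indicator {0..r} s * b s" for s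
      by (auto simp: u_def v_def indicator_def r_def)
    moreover have "(LINT s:{0..r}|lborel. a s) = (LINT s:{0..r}|lborel. b s)"
      using a b r unfolding ac_density_def by (metis add_left_cancel)
    ultimately show ?thesis
      by (simp only: set_lebesgue_integral_def real_scaleR_def)
  qed
  have total: "(LINT s|lborel. u s) = (LINT s|lborel. v s)"
  proof -
    have "indicator {..1} s * u s = u s" "indicator {..1} s * v s = v s" for s
      by (auto simp: u_def v_def indicator_def)
    then show ?thesis
      using upto[of 1] by (simp only: set_lebesgue_integral_def real_scaleR_def)
  qed
  have above: "(LINT s:{t<..}|lborel. u s) = (LINT s:{t<..}|lborel. v s)" for t
  proof -
    have *: "(LINT s:{t<..}|lborel. w s) = (LINT s|lborel. w s) - (LINT s:{..t}|lborel. w s)"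
      if w: "integrable lborel w" for w :: "real \<Rightarrow> real"
    proof -
      have "(LINT s:{t<..}|lborel. w s) = (LINT s|lborel. w s - indicator {..t} s * w s)"
        unfolding set_lebesgue_integral_def
        by (intro Bochner_Integration.integral_cong) (auto simp: indicator_def)
      also have "\<dots> = (LINT s|lborel. w s) - (LINT s:{..t}|lborel. w s)"
        using w integrable_mult_indicator[OF _ w, of "{..t}"]
        by (simp add: set_lebesgue_integral_def)
      finally show ?thesis .
    qed
    show ?thesis
      using *[OF u] *[OF v] upto total by simp
  qed
  define p where "p = (\<lambda>s. max 0 (u s) + max 0 (- v s))"
  define q where "q = (\<lambda>s. max 0 (v s) + max 0 (- u s))"
  have p: "integrable lborel p" and q: "integrable lborel q"
    using u v by (auto simp: p_def q_def intro!: Bochner_Integration.integrable_add integrable_max)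
  then have [measurable]: "p \<in> borel_measurable borel" "q \<in> borel_measurable borel"
    by auto
  have pq0: "0 \<le> p s" "0 \<le> q s" for s
    by (auto simp: p_def q_def)
  have pq: "p s - q s = u s - v s" for s
    by (auto simp: p_def q_def)
  have dens: "emeasure (density lborel (\<lambda>s. ennreal (w s))) {t<..}
      = ennreal (LINT s:{t<..}|lborel. w s)"
    if w: "integrable lborel w" and w0: "\<And>s. 0 \<le> w s" for w :: "real \<Rightarrow> real" and t
  proof -
    have "emeasure (density lborel (\<lambda>s. ennreal (w s))) {t<..}
        = (\<integral>\<^sup>+s. ennreal (indicator {t<..} s * w s) \<partial>lborel)"
      using w by (subst emeasure_density)
        (auto intro!: nn_integral_cong simp: indicator_def)
    also have "\<dots> = ennreal (LINT s|lborel. indicator {t<..} s * w s)"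
      using integrable_mult_indicator[OF _ w, of "{t<..}"] w0
      by (intro nn_integral_eq_integral) auto
    finally show ?thesis
      by (simp add: set_lebesgue_integral_def)
  qed
  have "(LINT s:{t<..}|lborel. p s) - (LINT s:{t<..}|lborel. q s)
      = (LINT s:{t<..}|lborel. u s) - (LINT s:{t<..}|lborel. v s)" for t
  proof -
    have si: "set_integrable lborel {t<..} w" if "integrable lborel w" for w :: "real \<Rightarrow> real"
      using that unfolding set_integrable_def by (intro integrable_mult_indicator) auto
    show ?thesis
      unfolding set_integral_diff(2)[OF si[OF p] si[OF q], symmetric]
        set_integral_diff(2)[OF si[OF u] si[OF v], symmetric] pq ..
  qed
  then have eq: "(LINT s:{t<..}|lborel. p s) = (LINT s:{t<..}|lborel. q s)" for t
    using above[of t] by (metis right_minus_eq)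
  have "density lborel (\<lambda>s. ennreal (p s)) = density lborel (\<lambda>s. ennreal (q s))"
    by (rule measure_eqI_lessThan) (simp_all add: dens[OF p pq0(1)] dens[OF q pq0(2)] eq)
  moreover have "(\<integral>\<^sup>+s. ennreal (p s) \<partial>lborel) \<noteq> \<infinity>"
    using p pq0 by (simp add: nn_integral_eq_integral)
  ultimately have "AE s in lborel. ennreal (p s) = ennreal (q s)"
    by (subst (asm) finite_density_unique) auto
  then show ?thesis
  proof eventually_elim
    case (elim s)
    then have "u s = v s"
      using pq0 pq[of s] by simp
    then show ?case
      by (auto simp: u_def v_def)
  qed
qed

lemma ac_integral_eq:
  assumes a: "ac_density x a" and g: "set_borel_measurable borel {0..1} g"
  shows "ac_integral g x = (LINT s:{0..1}|lborel. g s * a s)"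
proof -
  define b where "b = (SOME a. ac_density x a)"
  have b: "ac_density x b"
    unfolding b_def by (rule someI[of _ a]) (rule a)
  have m: "(\<lambda>s. indicator {0..1} s *\<^sub>R (g s * c s)) \<in> borel_measurable lborel"
    if "ac_density x c" for c
  proof -
    have "(\<lambda>s. indicator {0..1} s *\<^sub>R c s) \<in> borel_measurable lborel"
      using that unfolding ac_density_def set_integrable_def
      by (blast intro: borel_measurable_integrable)
    then have "(\<lambda>s. (indicator {0..1} s *\<^sub>R g s) * (indicator {0..1} s *\<^sub>R c s))
        \<in> borel_measurable lborel"
      using g by (intro borel_measurable_times) (simp_all add: set_borel_measurable_def)
    moreover have "(indicator {0..1} s *\<^sub>R g s) * (indicator {0..1} s *\<^sub>R c s)
        = indicator {0..1} s *\<^sub>R (g s * c s)" for s :: real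
      by (simp add: indicator_def)
    ultimately show ?thesis
      by (simp only:)
  qed
  show ?thesis
    unfolding ac_integral_def b_def[symmetric] set_lebesgue_integral_def
    by (rule integral_cong_AE[OF m[OF b] m[OF a]],
        use ac_density_unique[OF a b] in eventually_elim)
      (auto simp: indicator_def)
qed

definition wealth ::
  "real \<Rightarrow> ('a \<Rightarrow> real) \<Rightarrow> (real \<Rightarrow> 'a \<Rightarrow> real) \<Rightarrow> (real \<Rightarrow> real \<Rightarrow> real)
     \<Rightarrow> (real \<Rightarrow> 'a \<Rightarrow> real) \<Rightarrow> 'a \<Rightarrow> real" where
  "wealth \<sigma> V B H X \<omega> =
     ac_integral (\<lambda>s. V \<omega> - H s (total_demand \<sigma> B X s \<omega>)) (\<lambda>s. X s \<omega>)"

text \<open>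
  Expectations of wealth are taken in the extended reals: admissibility only bounds the negative
  part, and the Bochner integral of a function with infinite expectation would be \<open>0\<close>.
\<close>

definition extended_expectation :: "'a measure \<Rightarrow> ('a \<Rightarrow> real) \<Rightarrow> ereal" where
  "extended_expectation M W =
     enn2ereal (\<integral>\<^sup>+\<omega>. ennreal (W \<omega>) \<partial>M) - enn2ereal (\<integral>\<^sup>+\<omega>. ennreal (- W \<omega>) \<partial>M)"

definition admissible ::
  "real \<Rightarrow> (real \<Rightarrow> real) \<Rightarrow> ('a \<Rightarrow> real) \<Rightarrow> (real \<Rightarrow> 'a \<Rightarrow> real) \<Rightarrow> (real \<Rightarrow> 'a measure)
     \<Rightarrow> (real \<Rightarrow> real \<Rightarrow> real) \<Rightarrow> (real \<Rightarrow> 'a \<Rightarrow> real) set" where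
  "admissible \<sigma> f V B Pv H = {X.
     insider_strategy \<sigma> f V B Pv H X \<and>
     (\<forall>v\<in>range f. square_integrable_price \<sigma> B (Pv v) H X \<and>
        extended_expectation (completion (Pv v)) (\<lambda>\<omega>. min 0 (wealth \<sigma> V B H X \<omega>)) > -\<infinity>)}"

end

theory Submission
  imports Defs
begin

text \<open>
  Fix a value \<open>v\<close> of the asset. The heat equation for \<open>H\<close> makes the pair of equations
  \<open>G\<^sub>y = H - v\<close> and \<open>G\<^sub>t = - (\<sigma>\<^sup>2/2) H\<^sub>y\<close> solvable (\<open>insider_potential_exists\<close>), and the solution \<open>G\<close>
  satisfies the heat equation itself. Ito's formula for \<open>G(t, Y\<^sub>t)\<close>, where \<open>Y = Z + \<sigma> B\<close> is the total
  demand produced by a strategy \<open>Z\<close>, therefore has no drift apart from the wealth integral: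
  \<open>W = G(0,0) - G(1, Y\<^sub>1) + \<sigma> \<integral> (H(t, Y\<^sub>t) - v) dB\<^sub>t\<close>.
  The stochastic integral has mean zero because \<open>H(t, Y\<^sub>t)\<close> is square integrable, so the expected
  wealth is \<open>G(0,0)\<close> minus the expectation of \<open>G(1, Y\<^sub>1)\<close>. Since \<open>G(1, \<cdot>)\<close> has the increasing
  derivative \<open>H(1, \<cdot>) - v\<close>, it is smallest at the point \<open>a\<close> with \<open>H(1, a) = v\<close>. A strategy that
  drives the final price to \<open>v\<close> has \<open>Y\<^sub>1 = a\<close> and hence attains the bound \<open>G(0,0) - G(1, a)\<close>, which
  no admissible strategy exceeds.

  All that this argument asks of the stochastic integral is that it is integrable with mean zero, and
  this is proved without constructing it (\<open>ito_martingale_part\<close>). Define \<open>R\<close> as the difference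
  of the other terms of Ito's formula. For almost every path, \<open>R\<close> is the limit of the sums
  \<open>\<sigma> \<Sum> (H(t\<^sub>i, Y\<^sub>t\<^sub>i) - v) (B\<^sub>t\<^sub>i\<^sub>+\<^sub>1 - B\<^sub>t\<^sub>i)\<close> over the dyadic partitions of \<open>[0,1]\<close>: this is a Taylor expansion of \<open>G\<close>
  along the path (\<open>pathwise_ito\<close>), combined with the almost sure convergence of weighted quadratic
  variations of \<open>B\<close> along dyadic partitions (\<open>AE_weighted_quadratic_variation\<close>).
  The sums may fail to be integrable, so the demand in the weights is clipped to \<open>[-K, K]\<close>.
  The clipped sums have mean zero, and their second moments converge, as the mesh shrinks, to a
  quantity bounded uniformly in \<open>K\<close> by the square integrability of the price, because \<open>H\<close> is monotone
  in the demand. Choosing for each \<open>K\<close> a fine enough partition gives a sequence that is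
  bounded in mean square and has mean zero; it converges almost surely to \<open>R\<close>, since clipping
  eventually leaves a given continuous path alone. Such a limit is integrable with mean zero
  (\<open>limit_of_L2_bounded_mean_zero\<close>).

  Strategies are adapted only to the right-continuous completed filtration, so independence of the
  Brownian increments must first be transferred to it (\<open>brownian_motion_augmentation\<close>).
\<close>

section \<open>Riemann and Stieltjes sums over dyadic partitions\<close>

definition grid :: "nat \<Rightarrow> nat \<Rightarrow> real" where
  "grid m i = real i / 2 ^ m"

lemma grid_0 [simp]: "grid m 0 = 0"
  by (simp add: grid_def)

lemma grid_top [simp]: "grid m (2 ^ m) = 1"
  by (simp add: grid_def)

lemma grid_step: "grid m (Suc i) = grid m i + 1 / 2 ^ m"
  by (simp add: grid_def add_divide_distrib)

lemma grid_mono: "i \<le> j \<Longrightarrow> grid m i \<le> grid m j"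
  by (simp add: grid_def divide_right_mono)

lemma grid_nonneg [simp]: "0 \<le> grid m i"
  by (simp add: grid_def)

lemma grid_le_1: "i \<le> 2 ^ m \<Longrightarrow> grid m i \<le> 1"
  using grid_mono[of i "2 ^ m" m] by simp

lemma grid_interval_subset: "i < 2 ^ m \<Longrightarrow> {grid m i..grid m (Suc i)} \<subseteq> {0..1}"
  by (simp add: grid_le_1 Suc_leI)

lemma grid_in_unit: "i < 2 ^ m \<Longrightarrow> grid m i \<in> {0..1}" "i < 2 ^ m \<Longrightarrow> grid m (Suc i) \<in> {0..1}"
  by (auto intro!: grid_le_1)

lemma eventually_inverse_power2_less:
  "0 < d \<Longrightarrow> \<forall>\<^sub>F m in sequentially. 1 / 2 ^ m < (d::real)"
  using LIMSEQ_divide_realpow_zero[of 2 1] by (auto dest: order_tendstoD)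

lemma eventually_grid_oscillation_less:
  fixes g :: "real \<Rightarrow> 'b::metric_space"
  assumes g: "continuous_on {0..1} g" and e: "0 < e"
  shows "\<forall>\<^sub>F m in sequentially. \<forall>i<2 ^ m. \<forall>s\<in>{grid m i..grid m (Suc i)}.
           dist (g s) (g (grid m i)) < e"
proof -
  have "uniformly_continuous_on {0..1} g"
    using g by (intro compact_uniformly_continuous) auto
  then obtain d where d: "0 < d"
    "\<And>s t. s \<in> {0..1} \<Longrightarrow> t \<in> {0..1} \<Longrightarrow> dist s t < d \<Longrightarrow> dist (g s) (g t) < e"
    using e unfolding uniformly_continuous_on_def by metis
  show ?thesis
    using eventually_inverse_power2_less[OF d(1)]
  proof eventually_elim
    case (elim m)
    show ?case
    proof (intro allI impI ballI)
      fix i s assume i: "i < 2 ^ m" and s: "s \<in> {grid m i..grid m (Suc i)}"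
      show "dist (g s) (g (grid m i)) < e"
      proof (rule d(2))
        show "s \<in> {0..1}" "grid m i \<in> {0..1}"
          using subsetD[OF grid_interval_subset[OF i] s] grid_in_unit(1)[OF i] .
        show "dist s (grid m i) < d"
          using s elim by (auto simp: dist_real_def grid_step)
      qed
    qed
  qed
qed

lemma integral_grid_sum:
  assumes a: "a integrable_on {0..1::real}" and n: "n \<le> 2 ^ m"
  shows "(\<Sum>i<n. integral {grid m i..grid m (Suc i)} a) = integral {0..grid m n} (a :: real \<Rightarrow> real)"
  using n
proof (induction n)
  case (Suc n)
  have "integral {0..grid m n} a + integral {grid m n..grid m (Suc n)} a = integral {0..grid m (Suc n)} a"
    by (rule Henstock_Kurzweil_Integration.integral_combine)
      (use Suc.prems grid_le_1[of "Suc n" m] in \<open>auto intro!: grid_mono intro: integrable_on_subinterval[OF a]\<close>)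
  with Suc show ?case by simp
qed simp

lemma set_integrable_continuous_mult:
  fixes a g :: "real \<Rightarrow> real"
  assumes a: "set_integrable lborel {0..1} a" and g: "continuous_on {0..1} g"
  shows "set_integrable lborel {0..1} (\<lambda>s. g s * a s)"
proof -
  have "bounded (g ` {0..1})"
    using g by (intro compact_imp_bounded compact_continuous_image) auto
  then obtain C where C: "\<And>s. s \<in> {0..1} \<Longrightarrow> \<bar>g s\<bar> \<le> C"
    unfolding bounded_iff by (metis image_eqI real_norm_def)
  have "(\<lambda>s. indicator {0..1} s *\<^sub>R g s) \<in> borel_measurable borel"
    using g by (intro borel_measurable_continuous_on_indicator) auto
  then have "(\<lambda>s. (indicator {0..1} s *\<^sub>R g s) * (indicator {0..1} s *\<^sub>R a s)) \<in> borel_measurable lborel"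
    using a by (auto simp: set_integrable_def)
  then have m: "(\<lambda>s. indicator {0..1} s *\<^sub>R (g s * a s)) \<in> borel_measurable lborel"
    by (rule measurable_cong[THEN iffD1, rotated]) (auto simp: indicator_def)
  have "integrable lborel (\<lambda>s. C * (indicator {0..1} s *\<^sub>R a s))"
    using a by (auto simp: set_integrable_def)
  then show ?thesis
    unfolding set_integrable_def
    by (rule Bochner_Integration.integrable_bound)
      (use m C in \<open>auto simp: indicator_def abs_mult intro!: AE_I2 mult_right_mono intro: order_trans[OF _ abs_ge_self]\<close>)
qed

text \<open>
  On each cell the integrand differs from its value at the left end point by at most the oscillation
  of \<open>g\<close>, which tends to zero uniformly. With \<open>a = 1\<close> this is convergence of Riemann sums; with \<open>a\<close> the
  density of a path it is convergence of Stieltjes sums.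
\<close>

lemma sum_grid_integrals_tendsto:
  fixes a g :: "real \<Rightarrow> real"
  assumes a: "set_integrable lborel {0..1} a" and g: "continuous_on {0..1} g"
  shows "(\<lambda>m. \<Sum>i<2 ^ m. g (grid m i) * integral {grid m i..grid m (Suc i)} a)
           \<longlonglongrightarrow> (LINT s:{0..1}|lborel. g s * a s)"
proof (rule LIMSEQ_I)
  fix r :: real assume r: "0 < r"
  note ga = set_integrable_continuous_mult[OF a g]
  have hk: "a integrable_on {0..1}" "(\<lambda>s. g s * a s) integrable_on {0..1}" "(\<lambda>s. \<bar>a s\<bar>) integrable_on {0..1}"
    and eq: "(LINT s:{0..1}|lborel. g s * a s) = integral {0..1} (\<lambda>s. g s * a s)"
    using set_borel_integral_eq_integral[OF a] set_borel_integral_eq_integral[OF ga]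
      set_borel_integral_eq_integral(1)[OF set_integrable_abs[OF a]] by auto
  define L where "L = integral {0..1} (\<lambda>s. \<bar>a s\<bar>)"
  have L: "0 \<le> L" unfolding L_def by (rule Henstock_Kurzweil_Integration.integral_nonneg[OF hk(3)]) auto
  \<comment> \<open>\<open>L + 1\<close> instead of \<open>L\<close> avoids dividing by zero when \<open>a\<close> vanishes\<close>
  define e where "e = r / (L + 1)"
  have e: "0 < e" "e * L < r" using r L by (auto simp: e_def field_simps)
  have "\<forall>\<^sub>F m in sequentially. norm ((\<Sum>i<2 ^ m. g (grid m i) * integral {grid m i..grid m (Suc i)} a)
           - (LINT s:{0..1}|lborel. g s * a s)) < r"
    using eventually_grid_oscillation_less[OF g e(1)]
  proof eventually_elim
    case (elim m)
    let ?J = "\<lambda>i. {grid m i..grid m (Suc i)}"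
    have int: "a integrable_on ?J i" "(\<lambda>s. g s * a s) integrable_on ?J i" "(\<lambda>s. \<bar>a s\<bar>) integrable_on ?J i"
      if "i < 2 ^ m" for i
      using hk[THEN integrable_on_subinterval] grid_interval_subset[OF that] by blast+
    have step: "\<bar>g (grid m i) * integral (?J i) a - integral (?J i) (\<lambda>s. g s * a s)\<bar>
        \<le> e * integral (?J i) (\<lambda>s. \<bar>a s\<bar>)" if i: "i < 2 ^ m" for i
    proof -
      have "g (grid m i) * integral (?J i) a - integral (?J i) (\<lambda>s. g s * a s)
          = integral (?J i) (\<lambda>s. g (grid m i) * a s - g s * a s)"
        using int[OF i] by (subst Henstock_Kurzweil_Integration.integral_diff) (auto intro: integrable_on_mult_right)
      moreover have "norm \<dots> \<le> integral (?J i) (\<lambda>s. e * \<bar>a s\<bar>)"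
      proof (rule integral_norm_bound_integral)
        show "(\<lambda>s. g (grid m i) * a s - g s * a s) integrable_on ?J i" "(\<lambda>s. e * \<bar>a s\<bar>) integrable_on ?J i"
          using int[OF i] by (auto intro!: Henstock_Kurzweil_Integration.integrable_diff integrable_on_mult_right)
        fix s assume s: "s \<in> ?J i"
        then have "\<bar>g (grid m i) - g s\<bar> \<le> e"
          using elim i by (force simp: dist_real_def abs_minus_commute)
        then have "\<bar>g (grid m i) - g s\<bar> * \<bar>a s\<bar> \<le> e * \<bar>a s\<bar>"
          by (intro mult_right_mono) auto
        then show "norm (g (grid m i) * a s - g s * a s) \<le> e * \<bar>a s\<bar>"
          by (simp add: abs_mult[symmetric] algebra_simps)
      qed
      ultimately show ?thesis by simp
    qed
    have "(\<Sum>i<2 ^ m. g (grid m i) * integral (?J i) a) - (LINT s:{0..1}|lborel. g s * a s)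
        = (\<Sum>i<2 ^ m. g (grid m i) * integral (?J i) a - integral (?J i) (\<lambda>s. g s * a s))"
      using integral_grid_sum[OF hk(2), of "2 ^ m" m] by (simp add: eq sum_subtractf)
    also have "\<bar>\<dots>\<bar> \<le> (\<Sum>i<2 ^ m. e * integral (?J i) (\<lambda>s. \<bar>a s\<bar>))"
      by (intro order_trans[OF sum_abs] sum_mono step) auto
    also have "\<dots> = e * L"
      using integral_grid_sum[OF hk(3), of "2 ^ m" m] by (simp add: L_def sum_distrib_left[symmetric])
    finally show ?case using e(2) by simp
  qed
  then show "\<exists>no. \<forall>n\<ge>no. norm ((\<Sum>i<2 ^ n. g (grid n i) * integral {grid n i..grid n (Suc i)} a)
           - (LINT s:{0..1}|lborel. g s * a s)) < r"
    by (auto simp: eventually_sequentially)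
qed

text \<open>
  The form in which error terms are discarded: each summand is a vanishing factor times the summand
  of a sum that stays bounded, such as the variation of a path.
\<close>

lemma sum_dominated_tendsto_0:
  fixes u d :: "nat \<Rightarrow> nat \<Rightarrow> real"
  assumes u: "\<And>e. 0 < e \<Longrightarrow> \<forall>\<^sub>F m in sequentially. \<forall>i<2 ^ m. \<bar>u m i\<bar> \<le> e * d m i"
    and d: "\<forall>\<^sub>F m in sequentially. (\<Sum>i<2 ^ m. d m i) \<le> D"
  shows "(\<lambda>m. \<Sum>i<2 ^ m. u m i) \<longlonglongrightarrow> 0"
proof (rule tendstoI)
  fix r :: real assume r: "0 < r"
  define e where "e = r / (\<bar>D\<bar> + 1)"
  have e: "0 < e" "e * \<bar>D\<bar> < r" using r by (auto simp: e_def field_simps)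
  show "\<forall>\<^sub>F m in sequentially. dist (\<Sum>i<2 ^ m. u m i) 0 < r"
    using u[OF e(1)] d
  proof eventually_elim
    case (elim m)
    have "\<bar>\<Sum>i<2 ^ m. u m i\<bar> \<le> (\<Sum>i<2 ^ m. e * d m i)"
      using elim(1) by (intro order_trans[OF sum_abs] sum_mono) auto
    also have "\<dots> = e * (\<Sum>i<2 ^ m. d m i)" by (simp add: sum_distrib_left)
    also have "\<dots> \<le> e * \<bar>D\<bar>" using elim(2) e by (intro mult_left_mono) auto
    finally show ?case using e by simp
  qed
qed

lemma continuous_set_integrable:
  fixes g :: "real \<Rightarrow> real"
  assumes "continuous_on {0..1} g" shows "set_integrable lborel {0..1} g"
  using borel_integrable_atLeastAtMost'[OF assms] .

section \<open>Ito's formula along a single path\<close>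

lemma ac_density_eq_integral:
  assumes x: "ac_density x a" and t: "t \<in> {0..1}"
  shows "x t = x 0 + integral {0..t} a"
proof -
  have a: "set_integrable lborel {0..1} a" using x by (simp add: ac_density_def)
  have "set_integrable lborel {0..t} a" using t by (intro set_integrable_subset[OF a]) auto
  then have "(LINT s:{0..t}|lborel. a s) = integral {0..t} a"
    by (rule set_borel_integral_eq_integral(2))
  moreover have "x t = x 0 + (LINT s:{0..t}|lborel. a s)"
    using x t unfolding ac_density_def by blast
  ultimately show ?thesis by (simp only:)
qed

lemma ac_density_continuous:
  assumes x: "ac_density x a"
  shows "continuous_on {0..1} x"
proof -
  have a: "set_integrable lborel {0..1} a" using x by (simp add: ac_density_def)
  have "continuous_on {0..1} (\<lambda>t. x 0 + integral {0..t} a)"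
    by (intro continuous_intros indefinite_integral_continuous_1 set_borel_integral_eq_integral(1)[OF a])
  then show ?thesis
    by (rule continuous_on_eq) (rule ac_density_eq_integral[OF x, symmetric])
qed

lemma continuous_on_along_graph:
  fixes h :: "real \<Rightarrow> real \<Rightarrow> real"
  assumes "continuous_on ({0..1} \<times> UNIV) (\<lambda>(t, z). h t z)" "continuous_on S y" "S \<subseteq> {0..1}"
  shows "continuous_on S (\<lambda>s. h s (y s))"
proof -
  have "continuous_on S ((\<lambda>(t, z). h t z) \<circ> (\<lambda>s. (s, y s)))"
    using assms by (intro continuous_on_compose continuous_on_Pair continuous_on_id
        continuous_on_subset[OF assms(1)]) auto
  then show ?thesis by (simp add: comp_def)
qed

lemma continuous_on_compact_bound:
  fixes g :: "real \<Rightarrow> real \<Rightarrow> real"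
  assumes "continuous_on ({0..1} \<times> UNIV) (\<lambda>(t, z). g t z)"
  obtains C where "\<And>t z. t \<in> {0..1} \<Longrightarrow> z \<in> {-R..R} \<Longrightarrow> \<bar>g t z\<bar> \<le> C"
proof -
  have "bounded ((\<lambda>(t, z). g t z) ` ({0..1} \<times> {-R..R}))"
    by (intro compact_imp_bounded compact_continuous_image compact_Times
        continuous_on_subset[OF assms]) auto
  then obtain C where "\<forall>p\<in>(\<lambda>(t, z). g t z) ` ({0..1} \<times> {-R..R}). norm p \<le> C"
    unfolding bounded_iff by blast
  then show ?thesis by (intro that[of C]) force
qed

lemma continuous_on_section:
  fixes g :: "real \<Rightarrow> real \<Rightarrow> real"
  assumes "continuous_on ({0..1} \<times> UNIV) (\<lambda>(t, z). g t z)" "t \<in> {0..1}"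
  shows "continuous_on UNIV (g t)"
proof -
  have "continuous_on UNIV ((\<lambda>(t, z). g t z) \<circ> (\<lambda>z. (t, z)))"
    using assms(2) by (intro continuous_on_compose continuous_on_Pair continuous_on_id
        continuous_on_const continuous_on_subset[OF assms(1)]) auto
  then show ?thesis by (simp add: comp_def)
qed

text \<open>
  Ito's formula over one step, with an explicit error. Moving first in space at the old time \<open>t\<close> and
  then in time at the new position \<open>y'\<close> makes the first-order coefficient exactly \<open>h t y\<close>, so that no
  time derivative of \<open>h\<close> appears. The terms with \<open>k\<close> come from the second-order Taylor term and
  from the heat equation, and \<open>e\<close> bounds the oscillation of \<open>k\<close> over the step.
\<close>

lemma ito_increment_bound:
  fixes h k G :: "real \<Rightarrow> real \<Rightarrow> real"
  assumes t: "0 \<le> t" "t \<le> t'" "t' \<le> 1"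
    and h_deriv: "\<And>y. (h t has_real_derivative k t y) (at y)"
    and G_deriv: "\<And>y. (G t has_real_derivative h t y) (at y)"
    and G_time: "G t' y' - G t y' = - (\<sigma>\<^sup>2 / 2) * integral {t..t'} (\<lambda>s. k s y')"
    and k_cont: "continuous_on {t..t'} (\<lambda>s. k s y')"
    and osc: "\<And>s z. s \<in> {t..t'} \<Longrightarrow> z \<in> closed_segment y y' \<Longrightarrow> \<bar>k s z - k t y\<bar> \<le> e"
  shows "\<bar>G t' y' - G t y - h t y * (y' - y) - k t y / 2 * ((y' - y)\<^sup>2 - \<sigma>\<^sup>2 * (t' - t))\<bar>
           \<le> e / 2 * ((y' - y)\<^sup>2 + \<sigma>\<^sup>2 * (t' - t))"
proof -
  have "\<exists>z\<in>closed_segment y y'. G t y' = G t y + h t y * (y' - y) + k t z / 2 * (y' - y)\<^sup>2"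
  proof (cases "y = y'")
    case False
    define dif where "dif = (\<lambda>n::nat. if n = 0 then G t else if n = 1 then h t else k t)"
    have "\<forall>m z. m < 2 \<and> min y y' \<le> z \<and> z \<le> max y y' \<longrightarrow> DERIV (dif m) z :> dif (Suc m) z"
      using h_deriv G_deriv by (auto simp: dif_def less_2_cases_iff)
    then obtain z where z: "if y' < y then y' < z \<and> z < y else y < z \<and> z < y'"
      "G t y' = (\<Sum>m<2. dif m y / fact m * (y' - y) ^ m) + dif 2 z / fact 2 * (y' - y) ^ 2"
      using Taylor[of 2 dif "G t" "min y y'" "max y y'" y y'] False by (auto simp: dif_def)
    then have "z \<in> closed_segment y y'"
      by (auto simp: closed_segment_eq_real_ivl split: if_splits)
    with z(2) show ?thesis
      by (auto simp: dif_def numeral_2_eq_2)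
  qed auto
  then obtain z where z: "z \<in> closed_segment y y'"
    and Taylor: "G t y' = G t y + h t y * (y' - y) + k t z / 2 * (y' - y)\<^sup>2" by blast
  have "\<bar>integral {t..t'} (\<lambda>s. k s y' - k t y)\<bar> \<le> e * (t' - t)"
  proof -
    have "norm (integral {t..t'} (\<lambda>s. k s y' - k t y)) \<le> e * (t' - t)"
      by (rule integral_bound[OF t(2)]) (use osc in \<open>auto intro!: continuous_intros k_cont\<close>)
    then show ?thesis by simp
  qed
  moreover have "integral {t..t'} (\<lambda>s. k s y' - k t y) = integral {t..t'} (\<lambda>s. k s y') - k t y * (t' - t)"
    using t k_cont by (subst Henstock_Kurzweil_Integration.integral_diff) (auto intro: integrable_continuous_real)
  ultimately have time: "\<bar>integral {t..t'} (\<lambda>s. k s y') - k t y * (t' - t)\<bar> \<le> e * (t' - t)" by simp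
  have space: "\<bar>k t z - k t y\<bar> \<le> e" using osc[of t z] t z by auto
  have "G t' y' - G t y - h t y * (y' - y) - k t y / 2 * ((y' - y)\<^sup>2 - \<sigma>\<^sup>2 * (t' - t))
     = (k t z - k t y) * ((y' - y)\<^sup>2 / 2) - (integral {t..t'} (\<lambda>s. k s y') - k t y * (t' - t)) * (\<sigma>\<^sup>2 / 2)"
    using G_time Taylor by algebra
  also have "\<bar>\<dots>\<bar> \<le> \<bar>k t z - k t y\<bar> * ((y' - y)\<^sup>2 / 2) + \<bar>integral {t..t'} (\<lambda>s. k s y') - k t y * (t' - t)\<bar> * (\<sigma>\<^sup>2 / 2)"
    by (intro order_trans[OF abs_triangle_ineq4]) (simp add: abs_mult)
  also have "\<dots> \<le> e * ((y' - y)\<^sup>2 / 2) + e * (t' - t) * (\<sigma>\<^sup>2 / 2)"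
    using space time by (intro add_mono mult_right_mono) auto
  also have "\<dots> = e / 2 * ((y' - y)\<^sup>2 + \<sigma>\<^sup>2 * (t' - t))"
    by (simp add: field_simps)
  finally show ?thesis .
qed

text \<open>
  Summing the expansion over a dyadic partition telescopes the increments of \<open>G\<close>. The driving path
  \<open>b\<close> enters to second order only through its quadratic variation, which is assumed to be that of
  Brownian motion, also when weighted with \<open>k\<close>; this cancels the drift of the heat equation. The
  increments of the absolutely continuous part \<open>x\<close> are summable, so its quadratic variation
  and its covariation with \<open>b\<close> vanish. What is left is the statement that the sums replacing the
  stochastic integral converge.
\<close>

lemma pathwise_ito:
  fixes h k G :: "real \<Rightarrow> real \<Rightarrow> real" and b x a :: "real \<Rightarrow> real" and \<sigma> :: real
  defines "y \<equiv> \<lambda>t. x t + \<sigma> * b t"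
  assumes h_cont: "continuous_on ({0..1} \<times> UNIV) (\<lambda>(t, z). h t z)"
    and k_cont: "continuous_on ({0..1} \<times> UNIV) (\<lambda>(t, z). k t z)"
    and h_deriv: "\<And>t z. t \<in> {0..1} \<Longrightarrow> (h t has_real_derivative k t z) (at z)"
    and G_deriv: "\<And>t z. t \<in> {0..1} \<Longrightarrow> (G t has_real_derivative h t z) (at z)"
    and G_time: "\<And>t t' z. 0 \<le> t \<Longrightarrow> t \<le> t' \<Longrightarrow> t' \<le> 1 \<Longrightarrow>
                   G t' z - G t z = - (\<sigma>\<^sup>2 / 2) * integral {t..t'} (\<lambda>s. k s z)"
    and x: "ac_density x a"
    and b: "continuous_on {0..1} b"
    and qv: "(\<lambda>m. \<Sum>i<2 ^ m. (b (grid m (Suc i)) - b (grid m i))\<^sup>2 - 1 / 2 ^ m) \<longlonglongrightarrow> 0"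
    and kqv: "(\<lambda>m. \<Sum>i<2 ^ m. k (grid m i) (y (grid m i)) *
                ((b (grid m (Suc i)) - b (grid m i))\<^sup>2 - 1 / 2 ^ m)) \<longlonglongrightarrow> 0"
  shows "(\<lambda>m. \<sigma> * (\<Sum>i<2 ^ m. h (grid m i) (y (grid m i)) * (b (grid m (Suc i)) - b (grid m i))))
           \<longlonglongrightarrow> G 1 (y 1) - G 0 (y 0) - (LINT s:{0..1}|lborel. h s (y s) * a s)"
proof -
  have a: "set_integrable lborel {0..1} a" using x by (simp add: ac_density_def)
  have hk: "a integrable_on {0..1}" "(\<lambda>s. \<bar>a s\<bar>) integrable_on {0..1}"
    using set_borel_integral_eq_integral(1)[OF a]
      set_borel_integral_eq_integral(1)[OF set_integrable_abs[OF a]] by auto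
  note x_int = ac_density_eq_integral[OF x]
  have y_cont: "continuous_on {0..1} y"
    unfolding y_def by (intro continuous_intros ac_density_continuous[OF x] b)
  have hy_cont: "continuous_on {0..1} (\<lambda>s. h s (y s))"
    by (rule continuous_on_along_graph[OF h_cont y_cont]) simp
  define dx where "dx = (\<lambda>m i. x (grid m (Suc i)) - x (grid m i))"
  define db where "db = (\<lambda>m i. b (grid m (Suc i)) - b (grid m i))"
  define dy where "dy = (\<lambda>m i. y (grid m (Suc i)) - y (grid m i))"
  define H where "H = (\<lambda>m i. h (grid m i) (y (grid m i)))"
  define K where "K = (\<lambda>m i. k (grid m i) (y (grid m i)))"
  define r where "r = (\<lambda>m i. G (grid m (Suc i)) (y (grid m (Suc i))) - G (grid m i) (y (grid m i))
    - H m i * dy m i - K m i / 2 * ((dy m i)\<^sup>2 - \<sigma>\<^sup>2 * (1 / 2 ^ m)))"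
  define L where "L = integral {0..1} (\<lambda>s. \<bar>a s\<bar>)"
  have dy: "dy m i = dx m i + \<sigma> * db m i" for m i
    by (simp add: dy_def dx_def db_def y_def algebra_simps)
  have dx: "dx m i = integral {grid m i..grid m (Suc i)} a" if "i < 2 ^ m" for m i
  proof -
    have "integral {0..grid m i} a + integral {grid m i..grid m (Suc i)} a = integral {0..grid m (Suc i)} a"
      by (rule Henstock_Kurzweil_Integration.integral_combine)
        (use grid_in_unit[OF that] in \<open>auto intro!: grid_mono intro: integrable_on_subinterval[OF hk(1)]\<close>)
    then show ?thesis
      using x_int[OF grid_in_unit(1)[OF that]] x_int[OF grid_in_unit(2)[OF that]]
      unfolding dx_def by linarith
  qed
  have sum_dx: "(\<Sum>i<2 ^ m. \<bar>dx m i\<bar>) \<le> L" for m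
  proof -
    have "(\<Sum>i<2 ^ m. \<bar>dx m i\<bar>) \<le> (\<Sum>i<2 ^ m. integral {grid m i..grid m (Suc i)} (\<lambda>s. \<bar>a s\<bar>))"
    proof (rule sum_mono)
      fix i assume "i \<in> {..<(2::nat) ^ m}"
      then have i: "i < 2 ^ m" by simp
      have "norm (integral {grid m i..grid m (Suc i)} a) \<le> integral {grid m i..grid m (Suc i)} (\<lambda>s. \<bar>a s\<bar>)"
        using hk[THEN integrable_on_subinterval, OF grid_interval_subset[OF i]]
        by (intro integral_norm_bound_integral) auto
      then show "\<bar>dx m i\<bar> \<le> integral {grid m i..grid m (Suc i)} (\<lambda>s. \<bar>a s\<bar>)"
        by (simp add: dx[OF i])
    qed
    also have "\<dots> = L" using integral_grid_sum[OF hk(2), of "2 ^ m" m] by (simp add: L_def)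
    finally show ?thesis .
  qed
  have L: "0 \<le> L" using sum_dx[of 0] by (simp add: order_trans[OF abs_ge_zero])
  have dx_le: "\<bar>dx m i\<bar> \<le> L" if "i < 2 ^ m" for m i
    using member_le_sum[of i "{..<2 ^ m}" "\<lambda>i. \<bar>dx m i\<bar>"] that sum_dx[of m] by simp
  have sum_dx2: "(\<Sum>i<2 ^ m. (dx m i)\<^sup>2) \<le> L\<^sup>2" for m
  proof -
    have "(\<Sum>i<2 ^ m. (dx m i)\<^sup>2) \<le> (\<Sum>i<2 ^ m. L * \<bar>dx m i\<bar>)"
    proof (rule sum_mono)
      fix i assume "i \<in> {..<(2::nat) ^ m}"
      then have "\<bar>dx m i\<bar> * \<bar>dx m i\<bar> \<le> L * \<bar>dx m i\<bar>"
        using dx_le by (intro mult_right_mono) auto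
      then show "(dx m i)\<^sup>2 \<le> L * \<bar>dx m i\<bar>" by (simp add: power2_eq_square)
    qed
    also have "\<dots> \<le> L * L"
      using sum_dx[of m] L by (simp add: sum_distrib_left[symmetric] mult_left_mono)
    finally show ?thesis by (simp add: power2_eq_square)
  qed
  have "bounded (y ` {0..1})"
    using y_cont by (intro compact_imp_bounded compact_continuous_image) auto
  then obtain R where R: "\<And>s. s \<in> {0..1} \<Longrightarrow> \<bar>y s\<bar> \<le> R"
    unfolding bounded_iff by (metis image_eqI real_norm_def)
  let ?D = "{0..1} \<times> {-R..R}"
  have k_unif: "uniformly_continuous_on ?D (\<lambda>(t, z). k t z)"
    by (intro compact_uniformly_continuous compact_Times continuous_on_subset[OF k_cont]) auto
  obtain C where C: "\<And>t z. t \<in> {0..1} \<Longrightarrow> z \<in> {-R..R} \<Longrightarrow> \<bar>k t z\<bar> \<le> C"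
    using continuous_on_compact_bound[OF k_cont, of R] by blast
  have yR: "y (grid m i) \<in> {-R..R}" "y (grid m (Suc i)) \<in> {-R..R}" if "i < 2 ^ m" for m i
    using R[OF grid_in_unit(1)[OF that]] R[OF grid_in_unit(2)[OF that]] by auto
  have K_bound: "\<bar>K m i\<bar> \<le> C" if "i < 2 ^ m" for m i
    unfolding K_def by (intro C grid_in_unit yR that)
  have C0: "0 \<le> C" using K_bound[of 0 0] by simp
  have lim_h: "(\<lambda>m. \<Sum>i<2 ^ m. H m i * dx m i) \<longlonglongrightarrow> (LINT s:{0..1}|lborel. h s (y s) * a s)"
    using sum_grid_integrals_tendsto[OF a hy_cont] by (simp add: H_def dx)
  \<comment> \<open>second-order terms involving the absolutely continuous part: one factor tends to zero uniformly, the other has bounded variation\<close>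
  have lim_cross: "(\<lambda>m. \<Sum>i<2 ^ m. K m i * (dx m i + 2 * \<sigma> * db m i) * dx m i) \<longlonglongrightarrow> 0"
  proof (rule sum_dominated_tendsto_0[of _ "\<lambda>m i. \<bar>dx m i\<bar>" L])
    fix e :: real assume e: "0 < e"
    have cont: "continuous_on {0..1} (\<lambda>t. x t + 2 * \<sigma> * b t)"
      by (intro continuous_intros ac_density_continuous[OF x] b)
    have "0 < e / (C + 1)" using e C0 by simp
    from eventually_grid_oscillation_less[OF cont this]
    show "\<forall>\<^sub>F m in sequentially. \<forall>i<2 ^ m. \<bar>K m i * (dx m i + 2 * \<sigma> * db m i) * dx m i\<bar> \<le> e * \<bar>dx m i\<bar>"
    proof eventually_elim
      case (elim m)
      show ?case
      proof (intro allI impI)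
        fix i assume i: "i < (2::nat) ^ m"
        have "dist (x (grid m (Suc i)) + 2 * \<sigma> * b (grid m (Suc i))) (x (grid m i) + 2 * \<sigma> * b (grid m i)) < e / (C + 1)"
          using elim i grid_mono[of i "Suc i" m] by simp
        then have "\<bar>dx m i + 2 * \<sigma> * db m i\<bar> < e / (C + 1)"
          by (simp add: dx_def db_def dist_real_def algebra_simps)
        then have "\<bar>K m i\<bar> * \<bar>dx m i + 2 * \<sigma> * db m i\<bar> \<le> C * (e / (C + 1))"
          using K_bound[OF i] C0 by (intro mult_mono) auto
        also have "\<dots> \<le> e" using C0 e by (simp add: field_simps)
        finally show "\<bar>K m i * (dx m i + 2 * \<sigma> * db m i) * dx m i\<bar> \<le> e * \<bar>dx m i\<bar>"
          by (simp add: abs_mult mult_right_mono)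
      qed
    qed
  qed (simp add: sum_dx)
  \<comment> \<open>Taylor remainders: the oscillation of \<open>k\<close> is uniformly small on a compact set containing the path, and the quadratic variation stays bounded\<close>
  have lim_r: "(\<lambda>m. \<Sum>i<2 ^ m. r m i) \<longlonglongrightarrow> 0"
  proof (rule sum_dominated_tendsto_0[of _ "\<lambda>m i. ((dy m i)\<^sup>2 + \<sigma>\<^sup>2 * (1 / 2 ^ m)) / 2" "L\<^sup>2 + \<sigma>\<^sup>2 * 2 + \<sigma>\<^sup>2"])
    fix e :: real assume e: "0 < e"
    obtain d where d: "0 < d" "\<And>p q. p \<in> ?D \<Longrightarrow> q \<in> ?D \<Longrightarrow> dist p q < d \<Longrightarrow>
        dist ((\<lambda>(t, z). k t z) p) ((\<lambda>(t, z). k t z) q) < e"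
      using k_unif e unfolding uniformly_continuous_on_def by metis
    have "0 < d / 2" using d by simp
    from eventually_grid_oscillation_less[OF y_cont this] eventually_inverse_power2_less[OF this]
    show "\<forall>\<^sub>F m in sequentially. \<forall>i<2 ^ m. \<bar>r m i\<bar> \<le> e * (((dy m i)\<^sup>2 + \<sigma>\<^sup>2 * (1 / 2 ^ m)) / 2)"
    proof eventually_elim
      case (elim m)
      show ?case
      proof (intro allI impI)
        fix i assume i: "i < (2::nat) ^ m"
        let ?t = "grid m i" and ?t' = "grid m (Suc i)"
        have tt: "?t' - ?t = 1 / 2 ^ m" by (simp add: grid_step)
        have dist_y: "\<bar>y ?t' - y ?t\<bar> < d / 2"
          using elim(1) i grid_mono[of i "Suc i" m] by (auto simp: dist_real_def)
        have "\<bar>G ?t' (y ?t') - G ?t (y ?t) - h ?t (y ?t) * (y ?t' - y ?t)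
             - k ?t (y ?t) / 2 * ((y ?t' - y ?t)\<^sup>2 - \<sigma>\<^sup>2 * (?t' - ?t))\<bar>
           \<le> e / 2 * ((y ?t' - y ?t)\<^sup>2 + \<sigma>\<^sup>2 * (?t' - ?t))"
        proof (rule ito_increment_bound)
          show "0 \<le> ?t" "?t \<le> ?t'" "?t' \<le> 1"
            using grid_in_unit[OF i] by (auto intro: grid_mono)
          then show "G ?t' (y ?t') - G ?t (y ?t') = - (\<sigma>\<^sup>2 / 2) * integral {?t..?t'} (\<lambda>s. k s (y ?t'))"
            by (intro G_time)
          show "continuous_on {?t..?t'} (\<lambda>s. k s (y ?t'))"
            by (rule continuous_on_along_graph[OF k_cont continuous_on_const grid_interval_subset[OF i]])
          fix s z assume s: "s \<in> {?t..?t'}" and z: "z \<in> closed_segment (y ?t) (y ?t')"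
          have "closed_segment (y ?t) (y ?t') \<subseteq> {-R..R}"
            by (rule closed_segment_subset) (use yR[OF i] in auto)
          then have zR: "z \<in> {-R..R}" using z by auto
          have "\<bar>z - y ?t\<bar> \<le> \<bar>y ?t' - y ?t\<bar>"
            using z by (auto simp: closed_segment_eq_real_ivl split: if_splits)
          moreover have "\<bar>s - ?t\<bar> < d / 2" using s elim(2) tt by auto
          moreover have "dist (s, z) (?t, y ?t) \<le> \<bar>s - ?t\<bar> + \<bar>z - y ?t\<bar>"
            by (simp add: dist_Pair_Pair dist_real_def sqrt_sum_squares_le_sum_abs)
          ultimately have "dist (s, z) (?t, y ?t) < d" using dist_y by linarith
          then show "\<bar>k s z - k ?t (y ?t)\<bar> \<le> e"
            using d(2)[of "(s, z)" "(?t, y ?t)"] zR subsetD[OF grid_interval_subset[OF i] s]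
              grid_in_unit(1)[OF i] yR(1)[OF i]
            by (simp add: dist_real_def)
        qed (use h_deriv G_deriv grid_in_unit[OF i] in auto)
        then show "\<bar>r m i\<bar> \<le> e * (((dy m i)\<^sup>2 + \<sigma>\<^sup>2 * (1 / 2 ^ m)) / 2)"
          by (simp add: r_def dy_def H_def K_def tt)
      qed
    qed
  next
    have "\<forall>\<^sub>F m in sequentially. (\<Sum>i<2 ^ m. (db m i)\<^sup>2 - 1 / 2 ^ m) < 1"
      using order_tendstoD(2)[OF qv, of 1] by (simp add: db_def)
    then show "\<forall>\<^sub>F m in sequentially. (\<Sum>i<2 ^ m. ((dy m i)\<^sup>2 + \<sigma>\<^sup>2 * (1 / 2 ^ m)) / 2) \<le> L\<^sup>2 + \<sigma>\<^sup>2 * 2 + \<sigma>\<^sup>2"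
    proof eventually_elim
      case (elim m)
      have db2: "(\<Sum>i<2 ^ m. (db m i)\<^sup>2) \<le> 2" using elim by (simp add: sum_subtractf)
      have "((dy m i)\<^sup>2 + \<sigma>\<^sup>2 * (1 / 2 ^ m)) / 2 \<le> (dx m i)\<^sup>2 + \<sigma>\<^sup>2 * (db m i)\<^sup>2 + \<sigma>\<^sup>2 * (1 / 2 ^ m)" for i
      proof -
        have "(p + q)\<^sup>2 / 2 + c / 2 \<le> p\<^sup>2 + q\<^sup>2 + c" if "0 \<le> c" for p q c :: real
        proof -
          have "(p + q)\<^sup>2 / 2 + c / 2 = p\<^sup>2 + q\<^sup>2 + c - (p - q)\<^sup>2 / 2 - c / 2"
            by (simp add: power2_eq_square field_simps)
          then show ?thesis using zero_le_power2[of "p - q"] that by linarith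
        qed
        from this[of "\<sigma>\<^sup>2 * (1 / 2 ^ m)" "dx m i" "\<sigma> * db m i"]
        have "(dx m i + \<sigma> * db m i)\<^sup>2 / 2 + \<sigma>\<^sup>2 * (1 / 2 ^ m) / 2
            \<le> (dx m i)\<^sup>2 + \<sigma>\<^sup>2 * (db m i)\<^sup>2 + \<sigma>\<^sup>2 * (1 / 2 ^ m)"
          by (simp add: power_mult_distrib)
        then show ?thesis by (simp add: dy add_divide_distrib)
      qed
      then have "(\<Sum>i<2 ^ m. ((dy m i)\<^sup>2 + \<sigma>\<^sup>2 * (1 / 2 ^ m)) / 2)
          \<le> (\<Sum>i<2 ^ m. (dx m i)\<^sup>2 + \<sigma>\<^sup>2 * (db m i)\<^sup>2 + \<sigma>\<^sup>2 * (1 / 2 ^ m))"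
        by (intro sum_mono)
      also have "\<dots> = (\<Sum>i<2 ^ m. (dx m i)\<^sup>2) + \<sigma>\<^sup>2 * (\<Sum>i<2 ^ m. (db m i)\<^sup>2) + \<sigma>\<^sup>2"
        by (simp add: sum.distrib sum_distrib_left)
      also have "\<dots> \<le> L\<^sup>2 + \<sigma>\<^sup>2 * 2 + \<sigma>\<^sup>2"
        by (intro add_mono sum_dx2 mult_left_mono db2) auto
      finally show ?case .
    qed
  qed
  have "\<sigma> * (\<Sum>i<2 ^ m. H m i * db m i)
      = (G 1 (y 1) - G 0 (y 0)) - (\<Sum>i<2 ^ m. H m i * dx m i)
        - \<sigma>\<^sup>2 / 2 * (\<Sum>i<2 ^ m. K m i * ((db m i)\<^sup>2 - 1 / 2 ^ m))
        - (\<Sum>i<2 ^ m. K m i * (dx m i + 2 * \<sigma> * db m i) * dx m i) / 2 - (\<Sum>i<2 ^ m. r m i)" for m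
  proof -
    have "(\<Sum>i<2 ^ m. G (grid m (Suc i)) (y (grid m (Suc i))) - G (grid m i) (y (grid m i))) = G 1 (y 1) - G 0 (y 0)"
      by (subst sum_lessThan_telescope) simp
    moreover have "G (grid m (Suc i)) (y (grid m (Suc i))) - G (grid m i) (y (grid m i))
       = H m i * dx m i + \<sigma> * (H m i * db m i) + \<sigma>\<^sup>2 / 2 * (K m i * ((db m i)\<^sup>2 - 1 / 2 ^ m))
        + K m i * (dx m i + 2 * \<sigma> * db m i) * dx m i / 2 + r m i" for i
      by (simp add: r_def dy algebra_simps power2_eq_square)
    ultimately show ?thesis
      by (simp add: sum.distrib sum_distrib_left sum_divide_distrib)
  qed
  moreover have "(\<lambda>m. (G 1 (y 1) - G 0 (y 0)) - (\<Sum>i<2 ^ m. H m i * dx m i)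
        - \<sigma>\<^sup>2 / 2 * (\<Sum>i<2 ^ m. K m i * ((db m i)\<^sup>2 - 1 / 2 ^ m))
        - (\<Sum>i<2 ^ m. K m i * (dx m i + 2 * \<sigma> * db m i) * dx m i) / 2 - (\<Sum>i<2 ^ m. r m i))
      \<longlonglongrightarrow> (G 1 (y 1) - G 0 (y 0)) - (LINT s:{0..1}|lborel. h s (y s) * a s) - \<sigma>\<^sup>2 / 2 * 0 - 0 / 2 - 0"
    using kqv by (intro tendsto_intros lim_h lim_cross lim_r) (auto simp: K_def db_def)
  ultimately show ?thesis by (simp add: H_def db_def)
qed

section \<open>Brownian motion in the augmented filtration\<close>

text \<open>
  Sub-sigma-fields increasing over \<open>[0,1]\<close>: both a generated filtration and its augmentation, over the
  completed measure, are instances.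
\<close>

locale unit_filtration =
  fixes M :: "'a measure" and F :: "real \<Rightarrow> 'a measure"
  assumes subalg: "t \<in> {0..1} \<Longrightarrow> subalgebra M (F t)"
    and sets_mono: "0 \<le> s \<Longrightarrow> s \<le> t \<Longrightarrow> t \<le> 1 \<Longrightarrow> sets (F s) \<subseteq> sets (F t)"
begin

lemma measurable_filtration:
  "t \<in> {0..1} \<Longrightarrow> g \<in> measurable (F t) N \<Longrightarrow> g \<in> measurable M N"
  using measurable_from_subalg[OF subalg] .

lemma measurable_filtration_mono:
  assumes "0 \<le> s" "s \<le> t" "t \<le> 1" "g \<in> measurable (F s) N"
  shows "g \<in> measurable (F t) N"
proof (rule measurable_from_subalg)
  show "subalgebra (F t) (F s)"
    using assms subalg[of s] subalg[of t] sets_mono[of s t] by (simp add: subalgebra_def)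
qed fact

lemma right_limit_subset: "t \<in> {0..1} \<Longrightarrow> right_limit F t \<subseteq> sets M"
  using subalg[of t] subalg[of 1] unfolding right_limit_def subalgebra_def
  by (cases "t < 1") auto

lemma space_augmentation [simp]: "space (augmentation M F t) = space M"
  by (simp add: augmentation_def space_measure_of_conv)

lemma sets_augmentation:
  assumes "t \<in> {0..1}"
  shows "sets (augmentation M F t) = sigma_sets (space M) (right_limit F t \<union> null_sets (completion M))"
proof -
  have "a \<subseteq> space M" if "a \<in> right_limit F t \<union> null_sets (completion M)" for a
    using that
  proof
    assume "a \<in> right_limit F t"
    then show ?thesis using right_limit_subset[OF assms] sets.sets_into_space[of a M] by blast
  next
    assume "a \<in> null_sets (completion M)"
    then show ?thesis using sets.sets_into_space[of a "completion M"] by (simp add: null_sets_def)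
  qed
  then have "right_limit F t \<union> null_sets (completion M) \<subseteq> Pow (space M)" by blast
  then show ?thesis unfolding augmentation_def by (rule sets_measure_of)
qed

lemma subalgebra_augmentation:
  assumes "t \<in> {0..1}"
  shows "subalgebra (completion M) (augmentation M F t)"
proof -
  have "right_limit F t \<union> null_sets (completion M) \<subseteq> sets (completion M)"
    using right_limit_subset[OF assms] by (intro Un_least) (blast intro: sets_completionI_sets)+
  then have "sigma_sets (space (completion M)) (right_limit F t \<union> null_sets (completion M)) \<subseteq> sets (completion M)"
    by (rule sets.sigma_sets_subset)
  then show ?thesis
    using assms by (simp add: subalgebra_def sets_augmentation)
qed

lemma sets_augmentation_mono:
  assumes st: "0 \<le> s" "s \<le> t" "t \<le> 1"
  shows "sets (augmentation M F s) \<subseteq> sets (augmentation M F t)"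
proof -
  have "right_limit F s \<subseteq> right_limit F t"
  proof (cases "t < 1")
    case True
    then show ?thesis using st unfolding right_limit_def by auto
  next
    case False
    then have "t = 1" using st by simp
    then show ?thesis using st unfolding right_limit_def by (cases "s = 1") auto
  qed
  then have "sigma_sets (space M) (right_limit F s \<union> null_sets (completion M))
      \<subseteq> sigma_sets (space M) (right_limit F t \<union> null_sets (completion M))"
    by (intro sigma_sets_mono' Un_mono order_refl)
  then show ?thesis
    using st by (simp add: sets_augmentation)
qed

lemma unit_filtration_augmentation: "unit_filtration (completion M) (augmentation M F)"
  by standard (rule subalgebra_augmentation sets_augmentation_mono; assumption)+

lemma subalgebra_augmentation_filtration:
  assumes t: "t \<in> {0..1}"
  shows "subalgebra (augmentation M F t) (F t)"
proof -
  have "sets (F t) \<subseteq> right_limit F t"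
  proof (cases "t < 1")
    case True
    have "sets (F t) \<subseteq> sets (F s)" if "s \<in> {t<..1}" for s
      using t that by (intro sets_mono) auto
    then show ?thesis using True unfolding right_limit_def by (simp add: le_INF_iff)
  qed (simp add: right_limit_def)
  then have "sets (F t) \<subseteq> sets (augmentation M F t)"
    unfolding sets_augmentation[OF t] by (blast intro: sigma_sets.Basic)
  then show ?thesis using subalg[OF t] by (simp add: subalgebra_def)
qed

end

locale brownian_filtration = unit_filtration M F + prob_space M
  for M :: "'a measure" and F :: "real \<Rightarrow> 'a measure" +
  fixes B :: "real \<Rightarrow> 'a \<Rightarrow> real"
  assumes bm: "brownian_motion M F B"
begin

lemma B_adapted: "t \<in> {0..1} \<Longrightarrow> B t \<in> borel_measurable (F t)"
  using bm unfolding brownian_motion_def by blast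

lemma B_measurable: "t \<in> {0..1} \<Longrightarrow> B t \<in> borel_measurable M"
  using B_adapted measurable_filtration by blast

lemma AE_B_continuous: "AE \<omega> in M. continuous_on {0..1} (\<lambda>t. B t \<omega>)"
  using bm unfolding brownian_motion_def by (auto elim: eventually_mono)

lemma AE_B_0: "AE \<omega> in M. B 0 \<omega> = 0"
  using bm unfolding brownian_motion_def by (auto elim: eventually_mono)

lemma increment_distributed:
  "0 \<le> s \<Longrightarrow> s < t \<Longrightarrow> t \<le> 1 \<Longrightarrow>
     distributed M lborel (\<lambda>\<omega>. B t \<omega> - B s \<omega>) (normal_density 0 (sqrt (t - s)))"
  using bm unfolding brownian_motion_def by blast

lemma increment_indep:
  "0 \<le> s \<Longrightarrow> s < t \<Longrightarrow> t \<le> 1 \<Longrightarrow>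
     indep_set (sets (F s)) (sets (vimage_algebra (space M) (\<lambda>\<omega>. B t \<omega> - B s \<omega>) borel))"
  using bm unfolding brownian_motion_def by blast

text \<open>
  An event of the right limit at \<open>s\<close> belongs to \<open>F u\<close> for every \<open>u > s\<close> and so is independent of
  \<open>B t - B u\<close>. Let \<open>u\<close> decrease to \<open>s\<close>: by continuity of paths the event that the increment lies
  in a ray converges, except where the increment from \<open>s\<close> hits the end point of the ray, and that has
  probability zero because the increment has a density.
\<close>

lemma indep_ray_right_limit:
  assumes st: "0 \<le> s" "s < t" "t \<le> 1" and A: "A \<in> right_limit F s"
  shows "measure M (A \<inter> {\<omega> \<in> space M. B t \<omega> - B s \<omega> \<le> x})
    = measure M A * measure M {\<omega> \<in> space M. B t \<omega> - B s \<omega> \<le> x}"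
proof -
  have Ast [measurable]: "B t \<in> borel_measurable M" "B s \<in> borel_measurable M"
    using st by (auto intro!: B_measurable)
  have A_M [measurable]: "A \<in> sets M"
    using right_limit_subset[of s] A st by auto
  \<comment> \<open>the shift by \<open>2\<close> keeps \<open>u n\<close> strictly between \<open>s\<close> and \<open>t\<close>\<close>
  define u where "u = (\<lambda>n. s + (t - s) / real (n + 2))"
  have u: "s < u n" "u n < t" for n
  proof -
    have "(t - s) / real (n + 2) < (t - s) / 1"
      using st by (intro divide_strict_left_mono) auto
    then show "s < u n" "u n < t" using st by (auto simp: u_def)
  qed
  then have u01: "u n \<in> {0..1}" for n
  proof -
    have "s < u n" "u n < t" by (rule u)+
    then show ?thesis using st by simp
  qed
  have um [measurable]: "B (u n) \<in> borel_measurable M" for n using B_measurable[OF u01] .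
  have "(\<lambda>n. s + (t - s) * (1 / real (n + 2))) \<longlonglongrightarrow> s + (t - s) * 0"
    by (intro tendsto_intros LIMSEQ_ignore_initial_segment[of "\<lambda>n. 1 / real n", OF lim_1_over_n])
  then have u_lim: "u \<longlonglongrightarrow> s" by (simp add: u_def)
  define E where "E = (\<lambda>r. {\<omega> \<in> space M. B t \<omega> - B r \<omega> \<le> x})"
  have E_sets [measurable]: "E (u n) \<in> sets M" "E s \<in> sets M" for n
    unfolding E_def by measurable
  have indep: "prob (A \<inter> E (u n)) = prob A * prob (E (u n))" for n
  proof -
    have "indep_set (sets (F (u n))) (sets (vimage_algebra (space M) (\<lambda>\<omega>. B t \<omega> - B (u n) \<omega>) borel))"
      using u[of n] u01[of n] st by (intro increment_indep) auto
    moreover have "A \<in> sets (F (u n))"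
    proof -
      have "s < 1" "u n \<in> {s<..1}" using st u[of n] by auto
      then show ?thesis using A unfolding right_limit_def by auto
    qed
    moreover have "E (u n) \<in> sets (vimage_algebra (space M) (\<lambda>\<omega>. B t \<omega> - B (u n) \<omega>) borel)"
    proof -
      have "(\<lambda>\<omega>. B t \<omega> - B (u n) \<omega>) -` {..x} \<inter> space M \<in> sets (vimage_algebra (space M) (\<lambda>\<omega>. B t \<omega> - B (u n) \<omega>) borel)"
        by (rule in_vimage_algebra) simp
      moreover have "(\<lambda>\<omega>. B t \<omega> - B (u n) \<omega>) -` {..x} \<inter> space M = E (u n)"
        by (auto simp: E_def)
      ultimately show ?thesis by simp
    qed
    ultimately show ?thesis by (rule indep_setD)
  qed
  have ne: "AE \<omega> in M. B t \<omega> - B s \<omega> \<noteq> x"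
  proof -
    have d: "distributed M lborel (\<lambda>\<omega>. B t \<omega> - B s \<omega>) (normal_density 0 (sqrt (t - s)))"
      using st by (rule increment_distributed)
    have "AE z in lborel. 0 < ennreal (normal_density 0 (sqrt (t - s)) z) \<longrightarrow> z \<noteq> x"
      using AE_lborel_singleton[of x] by eventually_elim simp
    then have "AE z in density lborel (normal_density 0 (sqrt (t - s))). z \<noteq> x"
      by (subst AE_density) auto
    then have "AE z in distr M lborel (\<lambda>\<omega>. B t \<omega> - B s \<omega>). z \<noteq> x"
      unfolding distributed_distr_eq_density[OF d] .
    then show ?thesis by (rule AE_distrD[rotated]) measurable
  qed
  have lim: "AE \<omega> in M. (\<lambda>n. indicator (E (u n)) \<omega> :: real) \<longlonglongrightarrow> indicator (E s) \<omega>"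
    using ne AE_B_continuous AE_space
  proof eventually_elim
    case (elim \<omega>)
    have "(\<lambda>n. B (u n) \<omega>) \<longlonglongrightarrow> B s \<omega>"
      using u_lim u01 st by (intro continuous_on_tendsto_compose[OF elim(2)]) auto
    then have lim: "(\<lambda>n. B t \<omega> - B (u n) \<omega>) \<longlonglongrightarrow> B t \<omega> - B s \<omega>"
      by (intro tendsto_intros)
    show ?case
    proof (cases "B t \<omega> - B s \<omega> < x")
      case True
      from order_tendstoD(2)[OF lim True]
      have "\<forall>\<^sub>F n in sequentially. indicator (E (u n)) \<omega> = (indicator (E s) \<omega> :: real)"
        by eventually_elim (use True elim(3) in \<open>auto simp: E_def\<close>)
      then show ?thesis by (rule tendsto_eventually)
    next
      case False
      then have "x < B t \<omega> - B s \<omega>" using elim(1) by simp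
      from order_tendstoD(1)[OF lim this]
      have "\<forall>\<^sub>F n in sequentially. indicator (E (u n)) \<omega> = (indicator (E s) \<omega> :: real)"
        by eventually_elim (use False elim(1) in \<open>auto simp: E_def\<close>)
      then show ?thesis by (rule tendsto_eventually)
    qed
  qed
  have lim_prob: "(\<lambda>n. prob (C \<inter> E (u n))) \<longlonglongrightarrow> prob (C \<inter> E s)" if [measurable]: "C \<in> sets M" for C
  proof -
    have "(\<lambda>n. \<integral>\<omega>. indicator C \<omega> * indicator (E (u n)) \<omega> \<partial>M) \<longlonglongrightarrow> (\<integral>\<omega>. indicator C \<omega> * (indicator (E s) \<omega> :: real) \<partial>M)"
    proof (rule integral_dominated_convergence[where w="\<lambda>_. 1"])
      show "AE \<omega> in M. (\<lambda>n. indicator C \<omega> * indicator (E (u n)) \<omega> :: real) \<longlonglongrightarrow> indicator C \<omega> * indicator (E s) \<omega>"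
        using lim by eventually_elim (intro tendsto_intros)
    qed (auto simp: indicator_def)
    then show ?thesis
      by (simp add: indicator_inter_arith[symmetric] sets.sets_into_space[THEN Int_absorb2])
  qed
  have "(\<lambda>n. prob (A \<inter> E (u n))) \<longlonglongrightarrow> prob A * prob (E s)"
    unfolding indep using lim_prob[of "space M"] E_sets[THEN sets.sets_into_space]
    by (intro tendsto_intros) (simp add: Int_absorb1)
  then have "prob (A \<inter> E s) = prob A * prob (E s)"
    using lim_prob[OF A_M] LIMSEQ_unique by blast
  then show ?thesis by (simp add: E_def)
qed

text \<open>
  The right limit together with the null sets is closed under intersection and generates the
  augmentation, while rays generate the Borel sets; independence of these two systems therefore
  extends to the sigma-fields they generate.
\<close>

lemma brownian_motion_augmentation: "brownian_motion (completion M) (augmentation M F) B"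
proof -
  interpret C: prob_space "completion M" by (rule prob_space_completion)
  have "B t \<in> borel_measurable (augmentation M F t)" if t: "t \<in> {0..1}" for t
    using subalgebra_augmentation_filtration[OF t] B_adapted[OF t] by (rule measurable_from_subalg)
  moreover have "AE \<omega> in completion M. B 0 \<omega> = 0 \<and> continuous_on {0..1} (\<lambda>t. B t \<omega>)"
    using bm by (intro AE_completion) (simp add: brownian_motion_def)
  moreover have "distributed (completion M) lborel (\<lambda>\<omega>. B t \<omega> - B s \<omega>) (normal_density 0 (sqrt (t - s)))
    \<and> C.indep_set (sets (augmentation M F s))
          (sets (vimage_algebra (space (completion M)) (\<lambda>\<omega>. B t \<omega> - B s \<omega>) borel))"
    if st: "0 \<le> s" "s < t" "t \<le> 1" for s t
  proof
    let ?D = "\<lambda>\<omega>. B t \<omega> - B s \<omega>"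
    have D [measurable]: "?D \<in> borel_measurable M"
      using st by (auto intro!: borel_measurable_diff B_measurable)
    have d: "distributed M lborel ?D (normal_density 0 (sqrt (t - s)))"
      using st by (rule increment_distributed)
    then show "distributed (completion M) lborel ?D (normal_density 0 (sqrt (t - s)))"
      using measurable_completion[of ?D M lborel] distr_completion[of ?D M lborel]
      by (simp add: distributed_def)
    let ?rays = "range (\<lambda>x. {\<omega> \<in> space M. ?D \<omega> \<le> x})"
    let ?R = "right_limit F s \<union> null_sets (completion M)"
    have s01: "s \<in> {0..1}" using st by auto
    have RM: "right_limit F s \<subseteq> sets M" by (rule right_limit_subset[OF s01])
    have "C.indep_set ?R ?rays"
    proof (rule C.indep_setI)
      show "?R \<subseteq> C.events" using RM by (auto intro: sets_completionI_sets)
      have "?rays \<subseteq> sets M" by auto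
      then show "?rays \<subseteq> C.events" by (auto intro: sets_completionI_sets)
      fix A E assume A: "A \<in> ?R" and E: "E \<in> ?rays"
      then obtain x where E': "E = {\<omega> \<in> space M. ?D \<omega> \<le> x}" "E \<in> sets M" by auto
      show "C.prob (A \<inter> E) = C.prob A * C.prob E"
      proof (cases "A \<in> right_limit F s")
        case True
        then show ?thesis
          using indep_ray_right_limit[OF st True, of x] E' RM
          by (auto simp: measure_completion subset_iff sets.Int)
      next
        case False
        then have A: "A \<in> null_sets (completion M)" using A by auto
        have "E \<in> C.events" using E' by (auto intro: sets_completionI_sets)
        then have "A \<inter> E \<in> null_sets (completion M)" using A by (rule null_set_Int2[rotated])
        with A show ?thesis by (simp add: measure_eq_0_null_sets)
      qed
    qed
    moreover have "Int_stable ?R"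
    proof (rule Int_stableI)
      fix a b assume ab: "a \<in> ?R" "b \<in> ?R"
      have ev: "a \<in> C.events" "b \<in> C.events"
        using ab RM by (auto intro: sets_completionI_sets)
      consider "a \<in> right_limit F s" "b \<in> right_limit F s" | "a \<in> null_sets (completion M)"
        | "b \<in> null_sets (completion M)" using ab by blast
      then show "a \<inter> b \<in> ?R"
      proof cases
        case 1
        then show ?thesis by (auto simp: right_limit_def split: if_splits)
      next
        case 2
        then show ?thesis using null_set_Int2[OF 2 ev(2)] by auto
      next
        case 3
        then show ?thesis using null_set_Int1[OF 3 ev(1)] by auto
      qed
    qed
    moreover have "Int_stable ?rays"
    proof (rule Int_stableI)
      fix a b assume "a \<in> ?rays" "b \<in> ?rays"
      then obtain x y where "a = {\<omega> \<in> space M. ?D \<omega> \<le> x}" "b = {\<omega> \<in> space M. ?D \<omega> \<le> y}" by auto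
      then have "a \<inter> b = {\<omega> \<in> space M. ?D \<omega> \<le> min x y}" by auto
      then show "a \<inter> b \<in> ?rays" by blast
    qed
    ultimately have "C.indep_set (sigma_sets (space (completion M)) ?R) (sigma_sets (space (completion M)) ?rays)"
      by (rule C.indep_set_sigma_sets)
    moreover have "sigma_sets (space (completion M)) ?R = sets (augmentation M F s)"
      by (simp add: sets_augmentation[OF s01])
    moreover have "sigma_sets (space (completion M)) ?rays
       = sets (vimage_algebra (space (completion M)) ?D borel)"
    proof -
      have "sets (vimage_algebra (space M) ?D (sigma UNIV (range (\<lambda>x::real. {..x}))))
         = sets (sigma (space M) {?D -` A \<inter> space M | A. A \<in> range (\<lambda>x::real. {..x})})"
        by (subst vimage_algebra_sigma) auto
      also have "{?D -` A \<inter> space M | A. A \<in> range (\<lambda>x::real. {..x})} = ?rays"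
        by (auto simp: image_iff) blast+
      also have "sets (sigma (space M) ?rays) = sigma_sets (space M) ?rays"
        by (rule sets_measure_of) auto
      finally show ?thesis by (simp add: borel_eq_atMost)
    qed
    ultimately show "C.indep_set (sets (augmentation M F s))
          (sets (vimage_algebra (space (completion M)) ?D borel))" by simp
  qed
  ultimately show ?thesis
    using C.prob_space_axioms unfolding brownian_motion_def by blast
qed

lemma brownian_filtration_augmentation: "brownian_filtration (completion M) (augmentation M F) B"
  using unit_filtration_augmentation prob_space_completion brownian_motion_augmentation
  by (simp add: brownian_filtration_def brownian_filtration_axioms_def)

end

section \<open>Martingale differences and limits in mean square\<close>

text \<open>
  From independence of sigma-fields, as in the definition of Brownian motion, to independence of
  random variables, for which product formulas for expectations are available.
\<close>

lemma (in prob_space) indep_set_imp_indep_var: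
  fixes g D :: "'a \<Rightarrow> real"
  assumes G: "subalgebra M G"
    and indep: "indep_set (sets G) (sets (vimage_algebra (space M) D borel))"
    and g: "g \<in> borel_measurable G" and D: "D \<in> borel_measurable M"
  shows "indep_var borel g borel D"
proof -
  have sp: "space G = space M" using G by (simp add: subalgebra_def)
  have "indep_set (sigma_sets (space M) {g -` A \<inter> space M | A. A \<in> sets borel})
      (sigma_sets (space M) {D -` A \<inter> space M | A. A \<in> sets borel})"
  proof (rule indep_setI)
    have 1: "sigma_sets (space M) {g -` A \<inter> space M | A. A \<in> sets borel} \<subseteq> sets G"
      using measurable_sets[OF g] sp by (intro sets.sigma_sets_subset[of _ G, unfolded sp]) auto
    have 2: "sigma_sets (space M) {D -` A \<inter> space M | A. A \<in> sets borel}
        \<subseteq> sets (vimage_algebra (space M) D borel)"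
      by (simp add: sets_vimage_algebra)
    show "sigma_sets (space M) {g -` A \<inter> space M | A. A \<in> sets borel} \<subseteq> events"
      using 1 G by (auto simp: subalgebra_def)
    show "sigma_sets (space M) {D -` A \<inter> space M | A. A \<in> sets borel} \<subseteq> events"
      using measurable_sets[OF D] by (intro sets.sigma_sets_subset) auto
    fix a b
    assume "a \<in> sigma_sets (space M) {g -` A \<inter> space M | A. A \<in> sets borel}"
      "b \<in> sigma_sets (space M) {D -` A \<inter> space M | A. A \<in> sets borel}"
    then show "prob (a \<inter> b) = prob a * prob b"
      using 1 2 by (intro indep_setD[OF indep]) auto
  qed
  then show ?thesis
    using D measurable_from_subalg[OF G g] by (simp add: indep_var_eq)
qed

text \<open>
  Mixed terms have mean zero because the later difference is independent of everything before it and
  is centred. Bounded weights keep all products integrable.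
\<close>

lemma (in prob_space) martingale_difference_sum:
  fixes G :: "nat \<Rightarrow> 'a measure" and w D :: "nat \<Rightarrow> 'a \<Rightarrow> real"
  assumes G: "\<And>i. i \<le> n \<Longrightarrow> subalgebra M (G i)" "\<And>i. i < n \<Longrightarrow> sets (G i) \<subseteq> sets (G (Suc i))"
    and w: "\<And>i. i < n \<Longrightarrow> w i \<in> borel_measurable (G i)"
      "\<And>i \<omega>. i < n \<Longrightarrow> \<omega> \<in> space M \<Longrightarrow> \<bar>w i \<omega>\<bar> \<le> C"
    and D: "\<And>i. i < n \<Longrightarrow> D i \<in> borel_measurable (G (Suc i))"
      "\<And>i. i < n \<Longrightarrow> integrable M (\<lambda>\<omega>. (D i \<omega>)\<^sup>2)"
      "\<And>i. i < n \<Longrightarrow> expectation (D i) = 0"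
    and indep: "\<And>i g. i < n \<Longrightarrow> g \<in> borel_measurable (G i) \<Longrightarrow> indep_var borel g borel (D i)"
  shows "integrable M (\<lambda>\<omega>. (\<Sum>i<n. w i \<omega> * D i \<omega>)\<^sup>2)"
    and "expectation (\<lambda>\<omega>. \<Sum>i<n. w i \<omega> * D i \<omega>) = 0"
    and "expectation (\<lambda>\<omega>. (\<Sum>i<n. w i \<omega> * D i \<omega>)\<^sup>2)
      = (\<Sum>i<n. expectation (\<lambda>\<omega>. (w i \<omega>)\<^sup>2) * expectation (\<lambda>\<omega>. (D i \<omega>)\<^sup>2))"
proof -
  define S where "S = (\<lambda>j \<omega>. \<Sum>i<j. w i \<omega> * D i \<omega>)"
  have "S n \<in> borel_measurable (G n) \<and> integrable M (\<lambda>\<omega>. (S n \<omega>)\<^sup>2) \<and> expectation (S n) = 0 \<and>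
      expectation (\<lambda>\<omega>. (S n \<omega>)\<^sup>2) = (\<Sum>i<n. expectation (\<lambda>\<omega>. (w i \<omega>)\<^sup>2) * expectation (\<lambda>\<omega>. (D i \<omega>)\<^sup>2))"
    using assms
  proof (induction n)
    case 0
    then show ?case by (simp add: S_def)
  next
    case (Suc n)
    have IH: "S n \<in> borel_measurable (G n)" "integrable M (\<lambda>\<omega>. (S n \<omega>)\<^sup>2)" "expectation (S n) = 0"
      "expectation (\<lambda>\<omega>. (S n \<omega>)\<^sup>2) = (\<Sum>i<n. expectation (\<lambda>\<omega>. (w i \<omega>)\<^sup>2) * expectation (\<lambda>\<omega>. (D i \<omega>)\<^sup>2))"
      using Suc.IH Suc.prems by auto
    have subn: "subalgebra M (G n)" and subS: "subalgebra (G (Suc n)) (G n)"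
      using Suc.prems(1)[of n] Suc.prems(1)[of "Suc n"] Suc.prems(2)[of n] by (auto simp: subalgebra_def)
    have wG [measurable]: "w n \<in> borel_measurable (G n)" using Suc.prems by simp
    note SG [measurable] = IH(1)
    have wM: "w n \<in> borel_measurable M" and SM: "S n \<in> borel_measurable M"
      using measurable_from_subalg[OF subn] wG SG by blast+
    have DM: "D n \<in> borel_measurable M"
      using measurable_from_subalg[OF Suc.prems(1)[of "Suc n"]] Suc.prems(5)[of n] by simp
    note [measurable] = wM SM DM
    have SSuc: "S (Suc n) = (\<lambda>\<omega>. S n \<omega> + w n \<omega> * D n \<omega>)" by (auto simp: S_def)
    have D2: "integrable M (\<lambda>\<omega>. (D n \<omega>)\<^sup>2)" and ED: "expectation (D n) = 0"
      using Suc.prems by simp_all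
    have D1: "integrable M (D n)" by (rule square_integrable_imp_integrable[OF DM D2])
    have S1: "integrable M (S n)" by (rule square_integrable_imp_integrable[OF SM IH(2)])
    have wC: "AE \<omega> in M. norm (w n \<omega>) \<le> C" using Suc.prems(4) by auto
    have w1: "integrable M (w n)" by (rule integrable_const_bound[OF wC wM])
    have w2: "integrable M (\<lambda>\<omega>. (w n \<omega>)\<^sup>2)"
    proof (rule integrable_const_bound)
      show "AE \<omega> in M. norm ((w n \<omega>)\<^sup>2) \<le> C\<^sup>2"
        using wC by eventually_elim (simp add: abs_le_square_iff[symmetric] abs_of_nonneg order_trans[OF _ abs_ge_self])
    qed measurable
    have Sw: "integrable M (\<lambda>\<omega>. S n \<omega> * w n \<omega>)"
    proof (rule Bochner_Integration.integrable_bound)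
      show "integrable M (\<lambda>\<omega>. C * S n \<omega>)" using S1 by simp
      show "AE \<omega> in M. norm (S n \<omega> * w n \<omega>) \<le> norm (C * S n \<omega>)"
        using wC
      proof eventually_elim
        case (elim \<omega>)
        then have "\<bar>w n \<omega>\<bar> * \<bar>S n \<omega>\<bar> \<le> \<bar>C\<bar> * \<bar>S n \<omega>\<bar>"
          by (intro mult_right_mono) auto
        then show ?case by (simp add: abs_mult mult.commute)
      qed
    qed measurable
    have i1: "indep_var borel (w n) borel (D n)" by (rule Suc.prems(8)) auto
    have i2: "indep_var borel (\<lambda>\<omega>. S n \<omega> * w n \<omega>) borel (D n)" by (rule Suc.prems(8)) auto
    have i3: "indep_var borel (\<lambda>\<omega>. (w n \<omega>)\<^sup>2) borel (\<lambda>\<omega>. (D n \<omega>)\<^sup>2)"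
      using indep_var_compose[OF i1, of "\<lambda>x. x\<^sup>2" borel "\<lambda>x. x\<^sup>2" borel] by (simp add: comp_def)
    have wD: "integrable M (\<lambda>\<omega>. w n \<omega> * D n \<omega>)" "expectation (\<lambda>\<omega>. w n \<omega> * D n \<omega>) = 0"
      using indep_var_integrable[OF i1 w1 D1] indep_var_lebesgue_integral[OF i1 w1 D1] ED by auto
    have cross: "integrable M (\<lambda>\<omega>. S n \<omega> * w n \<omega> * D n \<omega>)" "expectation (\<lambda>\<omega>. S n \<omega> * w n \<omega> * D n \<omega>) = 0"
      using indep_var_integrable[OF i2 Sw D1] indep_var_lebesgue_integral[OF i2 Sw D1] ED by auto
    have w2D2: "integrable M (\<lambda>\<omega>. (w n \<omega>)\<^sup>2 * (D n \<omega>)\<^sup>2)"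
      "expectation (\<lambda>\<omega>. (w n \<omega>)\<^sup>2 * (D n \<omega>)\<^sup>2) = expectation (\<lambda>\<omega>. (w n \<omega>)\<^sup>2) * expectation (\<lambda>\<omega>. (D n \<omega>)\<^sup>2)"
      using indep_var_integrable[OF i3 w2 D2] indep_var_lebesgue_integral[OF i3 w2 D2] by auto
    have sq: "(\<lambda>\<omega>. (S (Suc n) \<omega>)\<^sup>2) = (\<lambda>\<omega>. (S n \<omega>)\<^sup>2 + 2 * (S n \<omega> * w n \<omega> * D n \<omega>) + (w n \<omega>)\<^sup>2 * (D n \<omega>)\<^sup>2)"
      by (auto simp: SSuc power2_eq_square algebra_simps)
    have "S (Suc n) \<in> borel_measurable (G (Suc n))"
    proof -
      have [measurable]: "w n \<in> borel_measurable (G (Suc n))" "S n \<in> borel_measurable (G (Suc n))"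
        by (rule measurable_from_subalg[OF subS]; fact)+
      have [measurable]: "D n \<in> borel_measurable (G (Suc n))" by (rule Suc.prems(5)) simp
      show ?thesis unfolding SSuc by measurable
    qed
    moreover have "expectation (S (Suc n)) = 0"
      using S1 wD IH(3) by (simp add: SSuc)
    moreover have "integrable M (\<lambda>\<omega>. (S (Suc n) \<omega>)\<^sup>2)"
      unfolding sq using IH(2) cross(1) w2D2(1) by auto
    moreover have "expectation (\<lambda>\<omega>. (S (Suc n) \<omega>)\<^sup>2) =
       (\<Sum>i<Suc n. expectation (\<lambda>\<omega>. (w i \<omega>)\<^sup>2) * expectation (\<lambda>\<omega>. (D i \<omega>)\<^sup>2))"
      unfolding sq using IH(2,4) cross w2D2 by (simp add: mult.assoc)
    ultimately show ?case by blast
  qed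
  then show "integrable M (\<lambda>\<omega>. (\<Sum>i<n. w i \<omega> * D i \<omega>)\<^sup>2)"
    and "expectation (\<lambda>\<omega>. \<Sum>i<n. w i \<omega> * D i \<omega>) = 0"
    and "expectation (\<lambda>\<omega>. (\<Sum>i<n. w i \<omega> * D i \<omega>)\<^sup>2)
      = (\<Sum>i<n. expectation (\<lambda>\<omega>. (w i \<omega>)\<^sup>2) * expectation (\<lambda>\<omega>. (D i \<omega>)\<^sup>2))"
    by (simp_all add: S_def)
qed

text \<open>
  The sum of the squares has finite expectation, hence is finite almost surely, and the terms of a
  convergent series tend to zero. This is why dyadic partitions are used: along them the second
  moments of the quadratic variation errors are summable.
\<close>

lemma (in prob_space) AE_tendsto_0_of_summable_second_moments:
  fixes Z :: "nat \<Rightarrow> 'a \<Rightarrow> real"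
  assumes Z: "\<And>m. Z m \<in> borel_measurable M" "\<And>m. integrable M (\<lambda>\<omega>. (Z m \<omega>)\<^sup>2)"
    and bound: "\<And>m. expectation (\<lambda>\<omega>. (Z m \<omega>)\<^sup>2) \<le> c m" and c: "summable c"
  shows "AE \<omega> in M. (\<lambda>m. Z m \<omega>) \<longlonglongrightarrow> 0"
proof -
  note [measurable] = Z(1)
  have c0: "0 \<le> c m" for m using bound[of m] by (rule order_trans[rotated]) simp
  have "(\<integral>\<^sup>+\<omega>. (\<Sum>m. ennreal ((Z m \<omega>)\<^sup>2)) \<partial>M) = (\<Sum>m. \<integral>\<^sup>+\<omega>. ennreal ((Z m \<omega>)\<^sup>2) \<partial>M)"
    by (rule nn_integral_suminf) measurable
  also have "\<dots> = (\<Sum>m. ennreal (expectation (\<lambda>\<omega>. (Z m \<omega>)\<^sup>2)))"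
    using Z by (intro suminf_cong nn_integral_eq_integral) auto
  also have "\<dots> \<le> (\<Sum>m. ennreal (c m))"
    using bound by (intro suminf_le ennreal_leI) auto
  also have "\<dots> = ennreal (suminf c)" by (rule suminf_ennreal2[OF c0 c])
  also have "\<dots> < \<infinity>" by simp
  finally have "(\<integral>\<^sup>+\<omega>. (\<Sum>m. ennreal ((Z m \<omega>)\<^sup>2)) \<partial>M) \<noteq> \<infinity>" by simp
  then have "AE \<omega> in M. (\<Sum>m. ennreal ((Z m \<omega>)\<^sup>2)) \<noteq> \<infinity>"
    by (intro nn_integral_PInf_AE) auto
  then show ?thesis
  proof eventually_elim
    case (elim \<omega>)
    then have "summable (\<lambda>m. (Z m \<omega>)\<^sup>2)"
      by (intro summable_suminf_not_top) (auto simp: infinity_ennreal_def)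
    from summable_LIMSEQ_zero[OF this] have "(\<lambda>m. \<bar>Z m \<omega>\<bar>) \<longlonglongrightarrow> 0"
      using tendsto_real_sqrt[of "\<lambda>m. (Z m \<omega>)\<^sup>2" 0] by simp
    then show ?case by (simp add: tendsto_rabs_zero_iff)
  qed
qed

text \<open>
  Fatou's lemma puts the limit into \<open>L\<^sup>2\<close>. A family bounded in \<open>L\<^sup>2\<close> is uniformly integrable, so
  means converge as well; concretely, truncation at level \<open>L\<close> changes every mean by at most
  \<open>C / L\<close>, and the truncated means converge by dominated convergence. The limit is only determined
  almost everywhere, hence the measurable version \<open>Y'\<close>.
\<close>

lemma (in prob_space) limit_of_L2_bounded_mean_zero:
  fixes Z :: "nat \<Rightarrow> 'a \<Rightarrow> real"
  assumes Z: "\<And>n. Z n \<in> borel_measurable M" "\<And>n. integrable M (\<lambda>\<omega>. (Z n \<omega>)\<^sup>2)"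
    and bound: "\<And>n. expectation (\<lambda>\<omega>. (Z n \<omega>)\<^sup>2) \<le> C" and mean: "\<And>n. expectation (Z n) = 0"
    and lim: "AE \<omega> in M. (\<lambda>n. Z n \<omega>) \<longlonglongrightarrow> Y \<omega>"
  obtains Y' where "integrable M Y'" "expectation Y' = 0" "AE \<omega> in M. Y \<omega> = Y' \<omega>"
proof
  define Y' where "Y' = (\<lambda>\<omega>. lim (\<lambda>n. Z n \<omega>))"
  note [measurable] = Z(1)
  have Y'_meas [measurable]: "Y' \<in> borel_measurable M"
    unfolding Y'_def by measurable
  show eq: "AE \<omega> in M. Y \<omega> = Y' \<omega>"
    using lim by eventually_elim (simp add: Y'_def limI)
  have lim': "AE \<omega> in M. (\<lambda>n. Z n \<omega>) \<longlonglongrightarrow> Y' \<omega>"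
    using lim eq by eventually_elim simp
  have Z1: "integrable M (Z n)" for n by (rule square_integrable_imp_integrable[OF Z])
  have C0: "0 \<le> C" using bound[of 0] by (rule order_trans[rotated]) simp
  have Zsq: "(\<integral>\<^sup>+\<omega>. ennreal ((Z n \<omega>)\<^sup>2) \<partial>M) \<le> ennreal C" for n
    using bound[of n] Z(2)[of n] by (subst nn_integral_eq_integral) (auto intro: ennreal_leI)
  have "(\<integral>\<^sup>+\<omega>. ennreal ((Y' \<omega>)\<^sup>2) \<partial>M) \<le> (\<integral>\<^sup>+\<omega>. liminf (\<lambda>n. ennreal ((Z n \<omega>)\<^sup>2)) \<partial>M)"
  proof (rule nn_integral_mono_AE)
    show "AE \<omega> in M. ennreal ((Y' \<omega>)\<^sup>2) \<le> liminf (\<lambda>n. ennreal ((Z n \<omega>)\<^sup>2))"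
      using lim'
    proof eventually_elim
      case (elim \<omega>)
      have "(\<lambda>n. ennreal ((Z n \<omega>)\<^sup>2)) \<longlonglongrightarrow> ennreal ((Y' \<omega>)\<^sup>2)"
        using elim by (intro tendsto_intros tendsto_ennrealI)
      from lim_imp_Liminf[OF sequentially_bot this] show ?case by simp
    qed
  qed
  also have "\<dots> \<le> liminf (\<lambda>n. \<integral>\<^sup>+\<omega>. ennreal ((Z n \<omega>)\<^sup>2) \<partial>M)"
    by (rule nn_integral_liminf) measurable
  also have "\<dots> \<le> liminf (\<lambda>n::nat. ennreal C)"
    by (intro Liminf_mono always_eventually allI Zsq)
  also have "\<dots> = ennreal C" by (simp add: Liminf_const)
  finally have Ysq: "(\<integral>\<^sup>+\<omega>. ennreal ((Y' \<omega>)\<^sup>2) \<partial>M) \<le> ennreal C" .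
  have Y2: "integrable M (\<lambda>\<omega>. (Y' \<omega>)\<^sup>2)"
  proof (rule integrableI_nonneg)
    show "(\<integral>\<^sup>+\<omega>. ennreal ((Y' \<omega>)\<^sup>2) \<partial>M) < \<infinity>"
      using Ysq by (rule le_less_trans) simp
  qed auto
  then have EY2: "expectation (\<lambda>\<omega>. (Y' \<omega>)\<^sup>2) \<le> C"
    using Ysq C0 by (simp add: nn_integral_eq_integral)
  show Y1: "integrable M Y'" by (rule square_integrable_imp_integrable[OF Y'_meas Y2])
  \<comment> \<open>truncation at level \<open>L\<close>; where it acts, the error is at most \<open>\<bar>x\<bar> \<le> x\<^sup>2 / L\<close>\<close>
  define T where "T = (\<lambda>L (x::real). max (-L) (min L x))"
  have T_meas [measurable]: "T L \<in> borel_measurable borel" for L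
    unfolding T_def by measurable
  have T_bound: "\<bar>T L x\<bar> \<le> L" if "0 \<le> L" for L x using that by (auto simp: T_def)
  have T_err: "\<bar>x - T L x\<bar> \<le> x\<^sup>2 / L" if "0 < L" for L x
  proof (cases "\<bar>x\<bar> \<le> L")
    case True
    then show ?thesis using that by (auto simp: T_def)
  next
    case False
    have "\<bar>x - T L x\<bar> \<le> \<bar>x\<bar>" using that by (auto simp: T_def)
    moreover have "L * \<bar>x\<bar> \<le> \<bar>x\<bar> * \<bar>x\<bar>" using False by (intro mult_right_mono) auto
    ultimately show ?thesis using that by (simp add: field_simps power2_eq_square)
      (meson mult_left_mono order_trans less_imp_le)
  qed
  have err: "\<bar>expectation X - expectation (\<lambda>\<omega>. T L (X \<omega>))\<bar> \<le> C / L"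
    if L: "0 < L" and X [measurable]: "X \<in> borel_measurable M" and X2: "integrable M (\<lambda>\<omega>. (X \<omega>)\<^sup>2)" and XC: "expectation (\<lambda>\<omega>. (X \<omega>)\<^sup>2) \<le> C" for L X
  proof -
    have X1: "integrable M X" by (rule square_integrable_imp_integrable[OF X X2])
    have TX: "integrable M (\<lambda>\<omega>. T L (X \<omega>))"
      using T_bound[of L] L by (intro integrable_const_bound[of _ L]) auto
    have "\<bar>expectation X - expectation (\<lambda>\<omega>. T L (X \<omega>))\<bar> = \<bar>expectation (\<lambda>\<omega>. X \<omega> - T L (X \<omega>))\<bar>"
      using X1 TX by simp
    also have "\<dots> \<le> expectation (\<lambda>\<omega>. \<bar>X \<omega> - T L (X \<omega>)\<bar>)" by (rule integral_abs_bound)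
    also have "\<dots> \<le> expectation (\<lambda>\<omega>. (X \<omega>)\<^sup>2 / L)"
      using X1 TX X2 T_err[OF L] by (intro integral_mono) auto
    also have "\<dots> \<le> C / L" using XC L by (simp add: divide_right_mono)
    finally show ?thesis .
  qed
  have "\<bar>expectation Y'\<bar> \<le> 2 * C / L" if L: "0 < L" for L
  proof -
    have "(\<lambda>n. expectation (\<lambda>\<omega>. T L (Z n \<omega>))) \<longlonglongrightarrow> expectation (\<lambda>\<omega>. T L (Y' \<omega>))"
    proof (rule integral_dominated_convergence[where w="\<lambda>_. L"])
      show "AE \<omega> in M. (\<lambda>n. T L (Z n \<omega>)) \<longlonglongrightarrow> T L (Y' \<omega>)"
        using lim' unfolding T_def by eventually_elim (intro tendsto_intros)
    qed (use T_bound[of L] L in auto)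
    then have "(\<lambda>n. \<bar>expectation (\<lambda>\<omega>. T L (Z n \<omega>))\<bar>) \<longlonglongrightarrow> \<bar>expectation (\<lambda>\<omega>. T L (Y' \<omega>))\<bar>"
      by (rule tendsto_rabs)
    moreover have "\<bar>expectation (\<lambda>\<omega>. T L (Z n \<omega>))\<bar> \<le> C / L" for n
      using err[OF L Z bound] mean by simp
    ultimately have "\<bar>expectation (\<lambda>\<omega>. T L (Y' \<omega>))\<bar> \<le> C / L"
      by (intro LIMSEQ_le_const2) auto
    with err[OF L Y'_meas Y2 EY2] show ?thesis by simp
  qed
  have "\<bar>expectation Y'\<bar> \<le> 2 * C * inverse (real (Suc n))" for n
    using \<open>\<And>L. 0 < L \<Longrightarrow> \<bar>expectation Y'\<bar> \<le> 2 * C / L\<close>[of "real (Suc n)"] by (simp add: divide_inverse)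
  moreover have "(\<lambda>n. 2 * C * inverse (real (Suc n))) \<longlonglongrightarrow> 2 * C * 0"
    by (intro tendsto_intros LIMSEQ_inverse_real_of_nat)
  ultimately have "\<bar>expectation Y'\<bar> \<le> 2 * C * 0"
    by (intro LIMSEQ_le_const) auto
  then show "expectation Y' = 0" by simp
qed

section \<open>Dyadic sums of Brownian increments\<close>

text \<open>
  Clipping the demand replaces the usual localisation by stopping times: it makes the weights bounded,
  preserves adaptedness trivially, and is inactive on every path that stays in \<open>[-K, K]\<close>.
\<close>

definition clip :: "real \<Rightarrow> real \<Rightarrow> real" where
  "clip K y = max (- K) (min K y)"

lemma clip_bounds: "0 \<le> K \<Longrightarrow> clip K y \<in> {- K..K}"
  by (auto simp: clip_def)

lemma clip_eq: "\<bar>y\<bar> \<le> K \<Longrightarrow> clip K y = y"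
  by (auto simp: clip_def)

lemma continuous_on_clip: "continuous_on S g \<Longrightarrow> continuous_on S (\<lambda>s. clip K (g s))"
  unfolding clip_def by (intro continuous_intros)

lemma clip_measurable [measurable]: "clip K \<in> borel_measurable borel"
  unfolding clip_def by measurable

text \<open>
  The clipped point lies between \<open>0\<close> and \<open>y\<close>, so a monotone function takes there a value between its
  values at \<open>0\<close> and \<open>y\<close>. This bounds clipped prices by true prices, uniformly in \<open>K\<close>.
\<close>

lemma mono_clip_abs_le:
  fixes g :: "real \<Rightarrow> real"
  assumes "mono g" "0 \<le> K"
  shows "\<bar>g (clip K y) - v\<bar> \<le> \<bar>g y - v\<bar> + \<bar>g 0 - v\<bar>"
proof (cases "0 \<le> y")
  case True
  then have "g 0 \<le> g (clip K y)" "g (clip K y) \<le> g y"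
    using assms by (auto simp: clip_def intro!: monoD[OF assms(1)])
  then show ?thesis by linarith
next
  case False
  then have "g (clip K y) \<le> g 0" "g y \<le> g (clip K y)"
    using assms by (auto simp: clip_def intro!: monoD[OF assms(1)])
  then show ?thesis by linarith
qed

context brownian_filtration
begin

lemma increment_moments:
  assumes st: "0 \<le> s" "s < t" "t \<le> 1"
  shows "integrable M (\<lambda>\<omega>. (B t \<omega> - B s \<omega>)\<^sup>2)"
    and "expectation (\<lambda>\<omega>. B t \<omega> - B s \<omega>) = 0"
    and "expectation (\<lambda>\<omega>. (B t \<omega> - B s \<omega>)\<^sup>2) = t - s"
    and "integrable M (\<lambda>\<omega>. ((B t \<omega> - B s \<omega>)\<^sup>2 - (t - s))\<^sup>2)"
    and "expectation (\<lambda>\<omega>. (B t \<omega> - B s \<omega>)\<^sup>2 - (t - s)) = 0"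
    and "expectation (\<lambda>\<omega>. ((B t \<omega> - B s \<omega>)\<^sup>2 - (t - s))\<^sup>2) = 2 * (t - s)\<^sup>2"
proof -
  define d where "d = t - s"
  have d: "0 < d" using st by (simp add: d_def)
  then have sd: "0 < sqrt d" by simp
  let ?D = "\<lambda>\<omega>. B t \<omega> - B s \<omega>"
  note dist = increment_distributed[OF st, folded d_def]
  have int: "integrable M (\<lambda>\<omega>. ?D \<omega> ^ k)" for k
    using integrable_normal_moment[OF sd, of 0 k] distributed_integrable[OF dist, of "\<lambda>x. x ^ k"] by simp
  have ev: "expectation (\<lambda>\<omega>. ?D \<omega> ^ (2 * k)) = fact (2 * k) / ((2 / d) ^ k * fact k)" for k
    using integral_normal_moment_even[OF sd, of 0 k] distributed_integral[OF dist, of "\<lambda>x. x ^ (2 * k)"] d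
    by simp
  have "expectation (\<lambda>\<omega>. ?D \<omega>) = 0"
    using integral_normal_moment_odd[OF sd, of 0 0] distributed_integral[OF dist, of "\<lambda>x. x"] by simp
  then show "expectation (\<lambda>\<omega>. B t \<omega> - B s \<omega>) = 0" .
  show i2: "integrable M (\<lambda>\<omega>. (?D \<omega>)\<^sup>2)" using int[of 2] .
  have e2: "expectation (\<lambda>\<omega>. (?D \<omega>)\<^sup>2) = d"
    using ev[of 1] d by (simp add: fact_numeral)
  then show "expectation (\<lambda>\<omega>. (B t \<omega> - B s \<omega>)\<^sup>2) = t - s" by (simp add: d_def)
  have e4: "expectation (\<lambda>\<omega>. (?D \<omega>) ^ 4) = 3 * d\<^sup>2"
    using ev[of 2] d by (simp add: fact_numeral power2_eq_square field_simps)
  have sq: "((?D \<omega>)\<^sup>2 - d)\<^sup>2 = (?D \<omega>) ^ 4 - 2 * d * (?D \<omega>)\<^sup>2 + d\<^sup>2" for \<omega>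
    by (simp add: power2_eq_square power4_eq_xxxx algebra_simps)
  show "integrable M (\<lambda>\<omega>. ((B t \<omega> - B s \<omega>)\<^sup>2 - (t - s))\<^sup>2)"
    unfolding d_def[symmetric] sq using int[of 4] i2 by simp
  show "expectation (\<lambda>\<omega>. (B t \<omega> - B s \<omega>)\<^sup>2 - (t - s)) = 0"
    unfolding d_def[symmetric] using i2 e2 by (simp add: prob_space)
  show "expectation (\<lambda>\<omega>. ((B t \<omega> - B s \<omega>)\<^sup>2 - (t - s))\<^sup>2) = 2 * (t - s)\<^sup>2"
    unfolding d_def[symmetric] sq using int[of 4] i2 e2 e4 by (simp add: prob_space power2_eq_square)
qed

abbreviation dB :: "nat \<Rightarrow> nat \<Rightarrow> 'a \<Rightarrow> real" where
  "dB m i \<omega> \<equiv> B (grid m (Suc i)) \<omega> - B (grid m i) \<omega>"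

lemma dB_moments:
  assumes i: "i < 2 ^ m"
  shows "integrable M (\<lambda>\<omega>. (dB m i \<omega>)\<^sup>2)" "expectation (dB m i) = 0"
    "expectation (\<lambda>\<omega>. (dB m i \<omega>)\<^sup>2) = 1 / 2 ^ m"
    "integrable M (\<lambda>\<omega>. ((dB m i \<omega>)\<^sup>2 - 1 / 2 ^ m)\<^sup>2)"
    "expectation (\<lambda>\<omega>. (dB m i \<omega>)\<^sup>2 - 1 / 2 ^ m) = 0"
    "expectation (\<lambda>\<omega>. ((dB m i \<omega>)\<^sup>2 - 1 / 2 ^ m)\<^sup>2) = 2 * (1 / 2 ^ m)\<^sup>2"
proof -
  have st: "0 \<le> grid m i" "grid m i < grid m (Suc i)" "grid m (Suc i) \<le> 1"
    using grid_in_unit[OF i] by (auto simp: grid_step)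
  have d: "grid m (Suc i) - grid m i = 1 / 2 ^ m" by (simp add: grid_step)
  note moments = increment_moments[OF st, unfolded d]
  show "integrable M (\<lambda>\<omega>. (dB m i \<omega>)\<^sup>2)" by (rule moments)
  show "expectation (dB m i) = 0" by (rule moments)
  show "expectation (\<lambda>\<omega>. (dB m i \<omega>)\<^sup>2) = 1 / 2 ^ m" by (rule moments)
  show "integrable M (\<lambda>\<omega>. ((dB m i \<omega>)\<^sup>2 - 1 / 2 ^ m)\<^sup>2)" by (rule moments)
  show "expectation (\<lambda>\<omega>. (dB m i \<omega>)\<^sup>2 - 1 / 2 ^ m) = 0" by (rule moments)
  show "expectation (\<lambda>\<omega>. ((dB m i \<omega>)\<^sup>2 - 1 / 2 ^ m)\<^sup>2) = 2 * (1 / 2 ^ m)\<^sup>2" by (rule moments)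
qed

lemma dB_adapted:
  assumes i: "i < 2 ^ m"
  shows "dB m i \<in> borel_measurable (F (grid m (Suc i)))"
proof (rule borel_measurable_diff)
  show "B (grid m (Suc i)) \<in> borel_measurable (F (grid m (Suc i)))"
    by (rule B_adapted[OF grid_in_unit(2)[OF i]])
  show "B (grid m i) \<in> borel_measurable (F (grid m (Suc i)))"
    using measurable_filtration_mono[OF _ _ _ B_adapted[OF grid_in_unit(1)[OF i]]]
      grid_mono[of i "Suc i" m] grid_in_unit[OF i] by auto
qed

lemma dB_indep:
  assumes i: "i < 2 ^ m" and g: "g \<in> borel_measurable (F (grid m i))"
  shows "indep_var borel g borel (dB m i)"
proof (rule indep_set_imp_indep_var[OF subalg _ g])
  show "grid m i \<in> {0..1}" by (rule grid_in_unit[OF i])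
  show "indep_set (sets (F (grid m i))) (sets (vimage_algebra (space M) (dB m i) borel))"
    using grid_in_unit[OF i] by (intro increment_indep) (auto simp: grid_step)
  show "dB m i \<in> borel_measurable M"
    by (rule measurable_filtration[OF grid_in_unit(2)[OF i] dB_adapted[OF i]])
qed

lemma weighted_dB_sum:
  assumes w: "\<And>i. i < 2 ^ m \<Longrightarrow> w i \<in> borel_measurable (F (grid m i))"
    and C: "\<And>i \<omega>. i < 2 ^ m \<Longrightarrow> \<omega> \<in> space M \<Longrightarrow> \<bar>w i \<omega>\<bar> \<le> C"
  shows "integrable M (\<lambda>\<omega>. (\<Sum>i<2 ^ m. w i \<omega> * dB m i \<omega>)\<^sup>2)"
    and "expectation (\<lambda>\<omega>. \<Sum>i<2 ^ m. w i \<omega> * dB m i \<omega>) = 0"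
    and "expectation (\<lambda>\<omega>. (\<Sum>i<2 ^ m. w i \<omega> * dB m i \<omega>)\<^sup>2)
      = (\<Sum>i<2 ^ m. expectation (\<lambda>\<omega>. (w i \<omega>)\<^sup>2) * (1 / 2 ^ m))"
proof -
  have G: "subalgebra M (F (grid m i))" if "i \<le> 2 ^ m" for i
    using that by (intro subalg) (auto intro: grid_le_1)
  have G': "sets (F (grid m i)) \<subseteq> sets (F (grid m (Suc i)))" if "i < 2 ^ m" for i
    using grid_in_unit[OF that] by (intro sets_mono) (auto intro: grid_mono)
  note mds = martingale_difference_sum[where n = "2 ^ m" and G = "\<lambda>i. F (grid m i)"
      and w = w and C = C and D = "dB m"]
  note prems = G G' w C dB_adapted dB_moments(1,2) dB_indep
  show "integrable M (\<lambda>\<omega>. (\<Sum>i<2 ^ m. w i \<omega> * dB m i \<omega>)\<^sup>2)"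
    by (rule mds(1)) (fact prems)+
  show "expectation (\<lambda>\<omega>. \<Sum>i<2 ^ m. w i \<omega> * dB m i \<omega>) = 0"
    by (rule mds(2)) (fact prems)+
  have "expectation (\<lambda>\<omega>. (\<Sum>i<2 ^ m. w i \<omega> * dB m i \<omega>)\<^sup>2)
      = (\<Sum>i<2 ^ m. expectation (\<lambda>\<omega>. (w i \<omega>)\<^sup>2) * expectation (\<lambda>\<omega>. (dB m i \<omega>)\<^sup>2))"
    by (rule mds(3)) (fact prems)+
  also have "\<dots> = (\<Sum>i<2 ^ m. expectation (\<lambda>\<omega>. (w i \<omega>)\<^sup>2) * (1 / 2 ^ m))"
    by (intro sum.cong refl) (simp only: lessThan_iff dB_moments(3))
  finally show "expectation (\<lambda>\<omega>. (\<Sum>i<2 ^ m. w i \<omega> * dB m i \<omega>)\<^sup>2)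
      = (\<Sum>i<2 ^ m. expectation (\<lambda>\<omega>. (w i \<omega>)\<^sup>2) * (1 / 2 ^ m))" .
qed

text \<open>
  The centred squares of the increments are themselves martingale differences with second moment
  \<open>2 \<cdot> 4\<^sup>-\<^sup>m\<close>; there are \<open>2\<^sup>m\<close> of them, so the second moment of the sum is of order \<open>2\<^sup>-\<^sup>m\<close>.
\<close>

lemma AE_weighted_quadratic_variation:
  assumes w: "\<And>m i. i < 2 ^ m \<Longrightarrow> w m i \<in> borel_measurable (F (grid m i))"
    and C: "\<And>m i \<omega>. i < 2 ^ m \<Longrightarrow> \<omega> \<in> space M \<Longrightarrow> \<bar>w m i \<omega>\<bar> \<le> C"
  shows "AE \<omega> in M. (\<lambda>m. \<Sum>i<2 ^ m. w m i \<omega> * ((dB m i \<omega>)\<^sup>2 - 1 / 2 ^ m)) \<longlonglongrightarrow> 0"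
proof (rule AE_tendsto_0_of_summable_second_moments)
  fix m
  let ?D = "\<lambda>i \<omega>. (dB m i \<omega>)\<^sup>2 - 1 / 2 ^ m"
  have G: "subalgebra M (F (grid m i))" if "i \<le> 2 ^ m" for i
    using that by (intro subalg) (auto intro: grid_le_1)
  have G': "sets (F (grid m i)) \<subseteq> sets (F (grid m (Suc i)))" if "i < 2 ^ m" for i
    using grid_in_unit[OF that] by (intro sets_mono) (auto intro: grid_mono)
  have D: "?D i \<in> borel_measurable (F (grid m (Suc i)))" if "i < 2 ^ m" for i
    by (intro borel_measurable_diff[of "\<lambda>\<omega>. (dB m i \<omega>)\<^sup>2"] borel_measurable_power dB_adapted that) simp
  have indep: "indep_var borel g borel (?D i)" if "i < 2 ^ m" "g \<in> borel_measurable (F (grid m i))" for i g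
    using indep_var_compose[OF dB_indep[OF that], of "\<lambda>x. x" borel "\<lambda>x. x\<^sup>2 - 1 / 2 ^ m" borel]
    by (simp add: comp_def)
  note mds = martingale_difference_sum[where n = "2 ^ m" and G = "\<lambda>i. F (grid m i)"
      and w = "w m" and C = C and D = ?D]
  note prems = G G' w C D dB_moments(4,5) indep
  have wM: "w m i \<in> borel_measurable M" "?D i \<in> borel_measurable M" if "i < 2 ^ m" for i
    using measurable_filtration grid_in_unit[OF that] w[OF that] D[OF that] by blast+
  show "(\<lambda>\<omega>. \<Sum>i<2 ^ m. w m i \<omega> * ?D i \<omega>) \<in> borel_measurable M"
    using wM by (intro borel_measurable_sum borel_measurable_times) auto
  show "integrable M (\<lambda>\<omega>. (\<Sum>i<2 ^ m. w m i \<omega> * ?D i \<omega>)\<^sup>2)" 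
    by (rule mds(1)) (fact prems)+
  have "expectation (\<lambda>\<omega>. (\<Sum>i<2 ^ m. w m i \<omega> * ?D i \<omega>)\<^sup>2)
      = (\<Sum>i<2 ^ m. expectation (\<lambda>\<omega>. (w m i \<omega>)\<^sup>2) * expectation (\<lambda>\<omega>. (?D i \<omega>)\<^sup>2))"
    by (rule mds(3)) (fact prems)+
  also have "\<dots> = (\<Sum>i<2 ^ m. expectation (\<lambda>\<omega>. (w m i \<omega>)\<^sup>2) * (2 * (1 / 2 ^ m)\<^sup>2))"
    by (intro sum.cong refl) (simp only: lessThan_iff dB_moments(6))
  also have "\<dots> \<le> (\<Sum>i<(2::nat) ^ m. C\<^sup>2 * (2 * (1 / 2 ^ m)\<^sup>2))"
  proof (intro sum_mono mult_right_mono)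
    fix i assume "i \<in> {..<(2::nat) ^ m}"
    then have i: "i < 2 ^ m" by simp
    have le: "(w m i \<omega>)\<^sup>2 \<le> C\<^sup>2" if "\<omega> \<in> space M" for \<omega>
      using power_mono[OF C[OF i that], of 2] by simp
    have "integrable M (\<lambda>\<omega>. (w m i \<omega>)\<^sup>2)"
      using le wM(1)[OF i] by (intro integrable_const_bound[of _ "C\<^sup>2"]) auto
    then show "expectation (\<lambda>\<omega>. (w m i \<omega>)\<^sup>2) \<le> C\<^sup>2"
      using le by (intro integral_le_const) auto
  qed simp
  also have "\<dots> = 2 * C\<^sup>2 * (1 / 2) ^ m"
    by (simp add: power2_eq_square power_one_over)
  finally show "expectation (\<lambda>\<omega>. (\<Sum>i<2 ^ m. w m i \<omega> * ?D i \<omega>)\<^sup>2) \<le> 2 * C\<^sup>2 * (1 / 2) ^ m" .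
next
  show "summable (\<lambda>m. 2 * C\<^sup>2 * (1 / 2) ^ m)"
    by (intro summable_mult summable_geometric) simp
qed

end

section \<open>The martingale part of Ito's formula\<close>

context brownian_filtration
begin

text \<open>
  The random variable \<open>R\<close> is what the theory of stochastic integration would write as
  \<open>\<sigma> \<integral> (H(t, Y\<^sub>t) - v) dB\<^sub>t\<close>.
\<close>

lemma ito_martingale_part:
  fixes H k G :: "real \<Rightarrow> real \<Rightarrow> real" and X a :: "real \<Rightarrow> 'a \<Rightarrow> real" and \<sigma> v :: real
  defines "Y \<equiv> \<lambda>t \<omega>. X t \<omega> + \<sigma> * B t \<omega>"
  assumes H_cont: "continuous_on ({0..1} \<times> UNIV) (\<lambda>(t, z). H t z)"
    and k_cont: "continuous_on ({0..1} \<times> UNIV) (\<lambda>(t, z). k t z)"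
    and H_mono: "\<And>t. t \<in> {0..1} \<Longrightarrow> mono (H t)"
    and H_deriv: "\<And>t z. t \<in> {0..1} \<Longrightarrow> (H t has_real_derivative k t z) (at z)"
    and G_deriv: "\<And>t z. t \<in> {0..1} \<Longrightarrow> (G t has_real_derivative H t z - v) (at z)"
    and G_time: "\<And>t t' z. 0 \<le> t \<Longrightarrow> t \<le> t' \<Longrightarrow> t' \<le> 1 \<Longrightarrow>
                   G t' z - G t z = - (\<sigma>\<^sup>2 / 2) * integral {t..t'} (\<lambda>s. k s z)"
    and X_adapted: "\<And>t. t \<in> {0..1} \<Longrightarrow> X t \<in> borel_measurable (F t)"
    and X_density: "AE \<omega> in M. ac_density (\<lambda>t. X t \<omega>) (\<lambda>t. a t \<omega>)"
    and square_integrable: "(\<integral>\<^sup>+\<omega>. (\<integral>\<^sup>+t\<in>{0..1}. ennreal ((H t (Y t \<omega>))\<^sup>2) \<partial>lborel) \<partial>M) < \<infinity>"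
  obtains R where "integrable M R" "expectation R = 0"
    "AE \<omega> in M. G 1 (Y 1 \<omega>) - G 0 (Y 0 \<omega>) - (LINT t:{0..1}|lborel. (H t (Y t \<omega>) - v) * a t \<omega>) = R \<omega>"
proof -
  define Rest where "Rest = (\<lambda>\<omega>. G 1 (Y 1 \<omega>) - G 0 (Y 0 \<omega>) - (LINT t:{0..1}|lborel. (H t (Y t \<omega>) - v) * a t \<omega>))"
  define w where "w = (\<lambda>(K::nat) m i \<omega>. H (grid m i) (clip (real K) (Y (grid m i) \<omega>)) - v)"
  define N where "N = (\<lambda>K m \<omega>. \<Sum>i<2 ^ m. w K m i \<omega> * dB m i \<omega>)"
  have Y_adapted: "Y t \<in> borel_measurable (F t)" if t: "t \<in> {0..1}" for t
    unfolding Y_def by (intro borel_measurable_add borel_measurable_times borel_measurable_const X_adapted B_adapted t)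
  have weight_meas: "(\<lambda>\<omega>. g (grid m i) (clip K (Y (grid m i) \<omega>))) \<in> borel_measurable (F (grid m i))"
    if g: "continuous_on ({0..1} \<times> UNIV) (\<lambda>(t, z). g t z)" and i: "i < 2 ^ m"
    for g :: "real \<Rightarrow> real \<Rightarrow> real" and K m i
  proof -
    have [measurable]: "g (grid m i) \<in> borel_measurable borel"
      by (intro borel_measurable_continuous_onI continuous_on_section[OF g] grid_in_unit i)
    have [measurable]: "Y (grid m i) \<in> borel_measurable (F (grid m i))"
      by (intro Y_adapted grid_in_unit i)
    show ?thesis by measurable
  qed
  have h_cont: "continuous_on ({0..1} \<times> UNIV) (\<lambda>(t, z). H t z - v)"
    using continuous_on_diff[OF H_cont continuous_on_const, of v] by (simp add: case_prod_unfold)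
  have w_meas: "w K m i \<in> borel_measurable (F (grid m i))" if i: "i < 2 ^ m" for K m i
    using weight_meas[OF h_cont i] by (simp add: w_def)
  have "\<exists>C. \<forall>t z. t \<in> {0..1} \<longrightarrow> z \<in> {-real K..real K} \<longrightarrow> \<bar>H t z - v\<bar> \<le> C" for K
    by (rule continuous_on_compact_bound[OF h_cont, of "real K"]) blast
  then obtain C where C: "\<And>K t z. t \<in> {0..1} \<Longrightarrow> z \<in> {-real K..real K} \<Longrightarrow> \<bar>H t z - v\<bar> \<le> C K" by metis
  have w_bound: "\<bar>w K m i \<omega>\<bar> \<le> C K" if "i < 2 ^ m" for K m i \<omega>
    unfolding w_def by (intro C grid_in_unit that clip_bounds) simp
  have N_moments: "integrable M (\<lambda>\<omega>. (N K m \<omega>)\<^sup>2)" "expectation (N K m) = 0"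
    "expectation (\<lambda>\<omega>. (N K m \<omega>)\<^sup>2) = (\<Sum>i<2 ^ m. expectation (\<lambda>\<omega>. (w K m i \<omega>)\<^sup>2) * (1 / 2 ^ m))" for K m
    unfolding N_def
    by (rule weighted_dB_sum(1); rule w_meas w_bound; assumption)
      (rule weighted_dB_sum(2) weighted_dB_sum(3); rule w_meas w_bound; assumption)+
  have paths: "AE \<omega> in M. continuous_on {0..1} (\<lambda>t. Y t \<omega>)"
    using X_density AE_B_continuous
  proof eventually_elim
    case (elim \<omega>)
    then show ?case
      unfolding Y_def by (intro continuous_on_add continuous_on_mult continuous_on_const ac_density_continuous[OF elim(1)])
  qed
  have path_bound: "\<exists>K0. \<forall>t\<in>{0..1}. \<bar>Y t \<omega>\<bar> \<le> real K0" if "continuous_on {0..1} (\<lambda>t. Y t \<omega>)" for \<omega>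
  proof -
    have "bounded ((\<lambda>t. Y t \<omega>) ` {0..1})"
      using that by (intro compact_imp_bounded compact_continuous_image) auto
    then obtain R where R: "\<And>t. t \<in> {0..1} \<Longrightarrow> \<bar>Y t \<omega>\<bar> \<le> R"
      unfolding bounded_iff by (metis image_eqI real_norm_def)
    moreover obtain K0 where "R \<le> real K0" using real_arch_simple by blast
    ultimately show ?thesis by (meson order_trans)
  qed

  have qv: "AE \<omega> in M. (\<lambda>m. \<Sum>i<2 ^ m. (dB m i \<omega>)\<^sup>2 - 1 / 2 ^ m) \<longlonglongrightarrow> 0"
    using AE_weighted_quadratic_variation[of "\<lambda>_ _ _. 1" 1] by simp
  have kqv: "AE \<omega> in M. \<forall>K::nat. (\<lambda>m. \<Sum>i<2 ^ m. k (grid m i) (clip (real K) (Y (grid m i) \<omega>))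
      * ((dB m i \<omega>)\<^sup>2 - 1 / 2 ^ m)) \<longlonglongrightarrow> 0"
  proof (subst AE_all_countable, intro allI)
    fix K :: nat
    obtain D where D: "\<And>t z. t \<in> {0..1} \<Longrightarrow> z \<in> {-real K..real K} \<Longrightarrow> \<bar>k t z\<bar> \<le> D"
      using continuous_on_compact_bound[OF k_cont, of "real K"] by blast
    show "AE \<omega> in M. (\<lambda>m. \<Sum>i<2 ^ m. k (grid m i) (clip (real K) (Y (grid m i) \<omega>))
      * ((dB m i \<omega>)\<^sup>2 - 1 / 2 ^ m)) \<longlonglongrightarrow> 0"
      by (rule AE_weighted_quadratic_variation[where C = D])
        (intro weight_meas k_cont D grid_in_unit clip_bounds; simp)+
  qed
  \<comment> \<open>on a fixed path clipping is inactive from some level \<open>K0\<close> on, and then all clipped sums coincide with the unclipped ones\<close>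
  have N_lim: "AE \<omega> in M. \<exists>K0. \<forall>m K. K0 \<le> K \<longrightarrow> N K m \<omega> = N K0 m \<omega> \<and> (\<lambda>m. \<sigma> * N K0 m \<omega>) \<longlonglongrightarrow> Rest \<omega>"
    using X_density AE_B_continuous paths qv kqv
  proof eventually_elim
    case (elim \<omega>)
    obtain K0 where K0: "\<And>t. t \<in> {0..1} \<Longrightarrow> \<bar>Y t \<omega>\<bar> \<le> real K0" using path_bound[OF elim(3)] by blast
    have clip: "clip (real K) (Y (grid m i) \<omega>) = Y (grid m i) \<omega>" if "K0 \<le> K" "i < 2 ^ m" for K m i
      using K0[OF grid_in_unit(1)[OF that(2)]] that(1) by (intro clip_eq) simp
    have N: "N K m \<omega> = (\<Sum>i<2 ^ m. (H (grid m i) (Y (grid m i) \<omega>) - v) * dB m i \<omega>)" if "K0 \<le> K" for K m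
      unfolding N_def w_def using clip[OF that] by (intro sum.cong) auto
    have "(\<lambda>m. \<sigma> * (\<Sum>i<2 ^ m. (H (grid m i) (X (grid m i) \<omega> + \<sigma> * B (grid m i) \<omega>) - v) * dB m i \<omega>)) \<longlonglongrightarrow>
       G 1 (X 1 \<omega> + \<sigma> * B 1 \<omega>) - G 0 (X 0 \<omega> + \<sigma> * B 0 \<omega>) -
       (LINT t:{0..1}|lborel. (H t (X t \<omega> + \<sigma> * B t \<omega>) - v) * a t \<omega>)"
    proof (rule pathwise_ito[where h = "\<lambda>t z. H t z - v" and k = k and x = "\<lambda>t. X t \<omega>" and b = "\<lambda>t. B t \<omega>"])
      show "(\<lambda>m. \<Sum>i<2 ^ m. k (grid m i) (X (grid m i) \<omega> + \<sigma> * B (grid m i) \<omega>) * ((dB m i \<omega>)\<^sup>2 - 1 / 2 ^ m)) \<longlonglongrightarrow> 0"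
      proof (rule Lim_transform_eventually)
        show "(\<lambda>m. \<Sum>i<2 ^ m. k (grid m i) (clip (real K0) (Y (grid m i) \<omega>)) * ((dB m i \<omega>)\<^sup>2 - 1 / 2 ^ m)) \<longlonglongrightarrow> 0"
          using elim(5) by blast
        show "\<forall>\<^sub>F m in sequentially. (\<Sum>i<2 ^ m. k (grid m i) (clip (real K0) (Y (grid m i) \<omega>)) * ((dB m i \<omega>)\<^sup>2 - 1 / 2 ^ m))
           = (\<Sum>i<2 ^ m. k (grid m i) (X (grid m i) \<omega> + \<sigma> * B (grid m i) \<omega>) * ((dB m i \<omega>)\<^sup>2 - 1 / 2 ^ m))"
          using clip[of K0] by (intro always_eventually allI sum.cong) (auto simp: Y_def)
      qed
      show "((\<lambda>z. H t z - v) has_real_derivative k t z) (at z)" if "t \<in> {0..1}" for t z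
        using DERIV_diff[OF H_deriv[OF that] DERIV_const] by simp
    qed (use h_cont k_cont G_deriv G_time elim in blast)+
    then have "(\<lambda>m. \<sigma> * N K0 m \<omega>) \<longlonglongrightarrow> Rest \<omega>"
      by (simp add: N Rest_def Y_def)
    then show ?case using N by (intro exI[of _ K0]) simp
  qed

  \<comment> \<open>a bound on the second moments of the clipped sums that does not depend on \<open>K\<close>\<close>
  define J where "J = enn2real (\<integral>\<^sup>+\<omega>. (\<integral>\<^sup>+t\<in>{0..1}. ennreal ((H t (Y t \<omega>))\<^sup>2) \<partial>lborel) \<partial>M)"
  have c0: "\<bar>H t 0 - v\<bar> \<le> C 0" if "t \<in> {0..1}" for t
    using C[OF that, of 0 0] by simp
  define c where "c = 2 * (\<bar>v\<bar> + C 0)\<^sup>2"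
  have clip_sq: "(H t (clip (real K) y) - v)\<^sup>2 \<le> 2 * (H t y)\<^sup>2 + c" if t: "t \<in> {0..1}" for K t y
  proof -
    have "\<bar>H t (clip (real K) y) - v\<bar> \<le> \<bar>H t y - v\<bar> + \<bar>H t 0 - v\<bar>"
      by (rule mono_clip_abs_le[OF H_mono[OF t]]) simp
    also have "\<dots> \<le> \<bar>H t y\<bar> + (\<bar>v\<bar> + C 0)" using c0[OF t] by linarith
    finally have "\<bar>H t (clip (real K) y) - v\<bar>\<^sup>2 \<le> (\<bar>H t y\<bar> + (\<bar>v\<bar> + C 0))\<^sup>2"
      by (intro power_mono) auto
    also have "\<dots> \<le> 2 * \<bar>H t y\<bar>\<^sup>2 + 2 * (\<bar>v\<bar> + C 0)\<^sup>2"
    proof -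
      have "(p + q)\<^sup>2 = 2 * p\<^sup>2 + 2 * q\<^sup>2 - (p - q)\<^sup>2" for p q :: real
        by (simp add: power2_eq_square algebra_simps)
      then show ?thesis by simp
    qed
    finally show ?thesis by (simp add: c_def)
  qed
  \<comment> \<open>for fixed \<open>K\<close> the second moments are expectations of Riemann sums \<open>S m\<close> of a bounded continuous function; requiring \<open>m \<ge> K\<close> makes the mesh tend to zero along the diagonal sequence chosen from this\<close>
  have N2: "\<exists>m\<ge>K. expectation (\<lambda>\<omega>. (N K m \<omega>)\<^sup>2) \<le> 2 * J + c + 1" for K
  proof -
    define S where "S = (\<lambda>m \<omega>. \<Sum>i<2 ^ m. (w K m i \<omega>)\<^sup>2 * (1 / 2 ^ m))"
    define L where "L = (\<lambda>\<omega>. lim (\<lambda>m. S m \<omega>))"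
    have wM [measurable]: "w K m i \<in> borel_measurable M" if "i < 2 ^ m" for m i
      using measurable_filtration[OF grid_in_unit(1)[OF that] w_meas[OF that]] .
    have S_meas [measurable]: "S m \<in> borel_measurable M" for m
      unfolding S_def using wM by (intro borel_measurable_sum borel_measurable_times borel_measurable_power) auto
    have L_meas [measurable]: "L \<in> borel_measurable M" unfolding L_def by measurable
    have w2_bound: "(w K m i \<omega>)\<^sup>2 \<le> (C K)\<^sup>2" if "i < 2 ^ m" for m i \<omega>
      using power_mono[OF w_bound[OF that], of K \<omega> 2] by simp
    have w2_int: "integrable M (\<lambda>\<omega>. (w K m i \<omega>)\<^sup>2)" if "i < 2 ^ m" for m i
      using w2_bound[OF that] wM[OF that] by (intro integrable_const_bound[of _ "(C K)\<^sup>2"]) auto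
    have S_bound: "\<bar>S m \<omega>\<bar> \<le> (C K)\<^sup>2" for m \<omega>
    proof -
      have "S m \<omega> \<le> (\<Sum>i<(2::nat) ^ m. (C K)\<^sup>2 * (1 / 2 ^ m))"
        unfolding S_def by (intro sum_mono mult_right_mono w2_bound) auto
      moreover have "0 \<le> S m \<omega>" unfolding S_def by (intro sum_nonneg) auto
      ultimately show ?thesis by simp
    qed
    have S_lim: "AE \<omega> in M. (\<lambda>m. S m \<omega>) \<longlonglongrightarrow> (LINT t:{0..1}|lborel. (H t (clip (real K) (Y t \<omega>)) - v)\<^sup>2)"
      using paths
    proof eventually_elim
      case (elim \<omega>)
      have cont: "continuous_on {0..1} (\<lambda>t. (H t (clip (real K) (Y t \<omega>)) - v)\<^sup>2)"
        by (intro continuous_on_power continuous_on_along_graph[OF h_cont] continuous_on_clip elim) simp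
      have "integral {grid m i..grid m (Suc i)} (\<lambda>_. 1) = 1 / (2::real) ^ m" for m i
        using grid_mono[of i "Suc i" m] by (simp add: grid_step)
      then show ?case
        using sum_grid_integrals_tendsto[OF continuous_set_integrable[OF continuous_on_const] cont, of 1]
        by (simp add: S_def w_def)
    qed
    have L_eq: "AE \<omega> in M. L \<omega> = (LINT t:{0..1}|lborel. (H t (clip (real K) (Y t \<omega>)) - v)\<^sup>2)"
      using S_lim by eventually_elim (simp add: L_def limI)
    have S_L: "AE \<omega> in M. (\<lambda>m. S m \<omega>) \<longlonglongrightarrow> L \<omega>"
      using S_lim L_eq by eventually_elim simp
    have ES: "(\<lambda>m. expectation (S m)) \<longlonglongrightarrow> expectation L"
      by (rule integral_dominated_convergence[where w = "\<lambda>_. (C K)\<^sup>2", OF L_meas S_meas _ S_L])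
        (simp_all add: S_bound)
    have L_int: "integrable M L"
      by (rule integrable_dominated_convergence[where w = "\<lambda>_. (C K)\<^sup>2", OF L_meas S_meas _ S_L])
        (simp_all add: S_bound)
    have L_le: "AE \<omega> in M. ennreal ((L \<omega> - c) / 2) \<le> (\<integral>\<^sup>+t\<in>{0..1}. ennreal ((H t (Y t \<omega>))\<^sup>2) \<partial>lborel)"
      using paths L_eq
    proof eventually_elim
      case (elim \<omega>)
      have cont1: "continuous_on {0..1} (\<lambda>t. (H t (clip (real K) (Y t \<omega>)) - v)\<^sup>2)"
        by (intro continuous_on_power continuous_on_along_graph[OF h_cont] continuous_on_clip elim) simp
      have cont2: "continuous_on {0..1} (\<lambda>t. (H t (Y t \<omega>))\<^sup>2)"
        by (intro continuous_on_power continuous_on_along_graph[OF H_cont] elim) simp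
      have "L \<omega> \<le> (LINT t:{0..1}|lborel. 2 * (H t (Y t \<omega>))\<^sup>2 + c)"
        unfolding elim(2) using clip_sq
        by (intro set_integral_mono continuous_set_integrable continuous_on_add continuous_on_mult
            continuous_on_const cont1 cont2) auto
      also have "\<dots> = 2 * (LINT t:{0..1}|lborel. (H t (Y t \<omega>))\<^sup>2) + c"
        by (subst set_integral_add(2)[OF continuous_set_integrable continuous_set_integrable])
          (simp_all add: continuous_on_mult cont2 set_lebesgue_integral_def)
      finally have "(L \<omega> - c) / 2 \<le> (LINT t:{0..1}|lborel. (H t (Y t \<omega>))\<^sup>2)" by simp
      then have "ennreal ((L \<omega> - c) / 2) \<le> ennreal (LINT t:{0..1}|lborel. (H t (Y t \<omega>))\<^sup>2)"
        by (rule ennreal_leI)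
      also have "\<dots> = (\<integral>\<^sup>+t. ennreal (indicator {0..1} t * (H t (Y t \<omega>))\<^sup>2) \<partial>lborel)"
        using continuous_set_integrable[OF cont2]
        unfolding set_lebesgue_integral_def set_integrable_def
        by (subst nn_integral_eq_integral) auto
      also have "\<dots> = (\<integral>\<^sup>+t\<in>{0..1}. ennreal ((H t (Y t \<omega>))\<^sup>2) \<partial>lborel)"
        by (intro nn_integral_cong) (auto simp: indicator_def)
      finally show ?case .
    qed
    have int: "integrable M (\<lambda>\<omega>. (L \<omega> - c) / 2)" using L_int by simp
    have "expectation (\<lambda>\<omega>. (L \<omega> - c) / 2) \<le> enn2real (\<integral>\<^sup>+\<omega>. ennreal ((L \<omega> - c) / 2) \<partial>M)"
      using real_lebesgue_integral_def[OF int] by simp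
    also have "\<dots> \<le> J"
      unfolding J_def using square_integrable by (intro enn2real_mono nn_integral_mono_AE L_le) (simp add: infinity_ennreal_def)
    finally have "expectation L \<le> 2 * J + c"
      using L_int by (simp add: prob_space)
    then have "expectation L < 2 * J + c + 1" by simp
    from eventually_conj[OF order_tendstoD(2)[OF ES this] eventually_ge_at_top[of K]]
    obtain m where m: "K \<le> m" "expectation (S m) < 2 * J + c + 1"
      by (auto dest!: eventually_happens)
    moreover have "expectation (\<lambda>\<omega>. (N K m \<omega>)\<^sup>2) = expectation (S m)"
      using w2_int unfolding N_moments(3) S_def by (subst Bochner_Integration.integral_sum) auto
    ultimately show ?thesis by (intro exI[of _ m]) auto
  qed
  then obtain \<mu> where \<mu>: "\<And>K. K \<le> \<mu> K" "\<And>K. expectation (\<lambda>\<omega>. (N K (\<mu> K) \<omega>)\<^sup>2) \<le> 2 * J + c + 1" by metis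
  have dBM: "dB m i \<in> borel_measurable M" if "i < 2 ^ m" for m i
    using measurable_filtration[OF grid_in_unit(2)[OF that] dB_adapted[OF that]] .
  have N_meas [measurable]: "N K m \<in> borel_measurable M" for K m
    unfolding N_def using measurable_filtration[OF grid_in_unit(1) w_meas] dBM
    by (intro borel_measurable_sum borel_measurable_times) auto
  show ?thesis
  proof (rule limit_of_L2_bounded_mean_zero[of "\<lambda>K \<omega>. \<sigma> * N K (\<mu> K) \<omega>" "\<sigma>\<^sup>2 * (2 * J + c + 1)" Rest])
    show "(\<lambda>\<omega>. \<sigma> * N K (\<mu> K) \<omega>) \<in> borel_measurable M" for K by measurable
    show "integrable M (\<lambda>\<omega>. (\<sigma> * N K (\<mu> K) \<omega>)\<^sup>2)" for K
      using N_moments(1) by (simp add: power_mult_distrib)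
    show "expectation (\<lambda>\<omega>. (\<sigma> * N K (\<mu> K) \<omega>)\<^sup>2) \<le> \<sigma>\<^sup>2 * (2 * J + c + 1)" for K
      using \<mu>(2)[of K] by (simp add: power_mult_distrib mult_left_mono)
    show "expectation (\<lambda>\<omega>. \<sigma> * N K (\<mu> K) \<omega>) = 0" for K
      using N_moments(2) by simp
    show "AE \<omega> in M. (\<lambda>K. \<sigma> * N K (\<mu> K) \<omega>) \<longlonglongrightarrow> Rest \<omega>"
      using N_lim
    proof eventually_elim
      case (elim \<omega>)
      then obtain K0 where K0: "\<And>m K. K0 \<le> K \<Longrightarrow> N K m \<omega> = N K0 m \<omega>" "(\<lambda>m. \<sigma> * N K0 m \<omega>) \<longlonglongrightarrow> Rest \<omega>"
        by blast
      have "filterlim \<mu> at_top sequentially"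
        using \<mu>(1) by (intro filterlim_at_top_mono[OF filterlim_ident]) auto
      from filterlim_compose[OF K0(2) this]
      have "(\<lambda>K. \<sigma> * N K0 (\<mu> K) \<omega>) \<longlonglongrightarrow> Rest \<omega>" .
      moreover have "\<forall>\<^sub>F K in sequentially. \<sigma> * N K0 (\<mu> K) \<omega> = \<sigma> * N K (\<mu> K) \<omega>"
        using eventually_ge_at_top[of K0]
      proof eventually_elim
        case (elim K)
        show ?case unfolding K0(1)[OF elim, of "\<mu> K"] ..
      qed
      ultimately show ?case by (rule Lim_transform_eventually)
    qed
    fix R assume "integrable M R" "expectation R = 0" "AE \<omega> in M. Rest \<omega> = R \<omega>"
    then show thesis unfolding Rest_def by (rule that)
  qed
qed

end

section \<open>The insider's potential\<close>

lemma C12_D_y: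
  "C12 H \<Longrightarrow> 0 \<le> t \<Longrightarrow> (H t has_real_derivative D_y H t y) (at y)"
  unfolding C12_def D_y_def using DERIV_deriv_iff_real_differentiable by blast

lemma C12_D_yy:
  "C12 H \<Longrightarrow> 0 \<le> t \<Longrightarrow> (D_y H t has_real_derivative D_yy H t y) (at y)"
  unfolding C12_def D_yy_def using DERIV_deriv_iff_real_differentiable by blast

lemma C12_D_t:
  "C12 H \<Longrightarrow> 0 \<le> t \<Longrightarrow> ((\<lambda>s. H s y) has_vector_derivative D_t H t y) (at t within {0..})"
  unfolding C12_def D_t_def using vector_derivative_works by blast

lemma C12_continuous:
  assumes "C12 H"
  shows "continuous_on ({0..1} \<times> UNIV) (\<lambda>(t, y). H t y)"
    and "continuous_on ({0..1} \<times> UNIV) (\<lambda>(t, y). D_y H t y)"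
    and "continuous_on ({0..1} \<times> UNIV) (\<lambda>(t, y). D_yy H t y)"
  using assms unfolding C12_def by (auto elim!: continuous_on_subset)

text \<open>
  Take an antiderivative of \<open>H 1 - v\<close> at time \<open>1\<close> and continue it to earlier times by integrating
  \<open>(\<sigma>\<^sup>2/2) H\<^sub>y\<close>. Differentiating in space under the integral produces \<open>(\<sigma>\<^sup>2/2) H\<^sub>y\<^sub>y = - H\<^sub>t\<close>, whose
  time integral turns \<open>H 1 - v\<close> into \<open>H t - v\<close>. Defining the time dependence through an
  integral gives the second equation directly and avoids the one-sided time derivative of \<open>G\<close> at \<open>0\<close>.
\<close>

lemma insider_potential_exists:
  fixes H :: "real \<Rightarrow> real \<Rightarrow> real" and \<sigma> v :: real
  assumes H: "C12 H"
    and heat: "\<And>t y. 0 \<le> t \<Longrightarrow> D_t H t y + \<sigma>\<^sup>2 / 2 * D_yy H t y = 0"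
  obtains G :: "real \<Rightarrow> real \<Rightarrow> real" where
    "\<And>t z. t \<in> {0..1} \<Longrightarrow> (G t has_real_derivative H t z - v) (at z)"
    "\<And>t t' z. 0 \<le> t \<Longrightarrow> t \<le> t' \<Longrightarrow> t' \<le> 1 \<Longrightarrow>
        G t' z - G t z = - (\<sigma>\<^sup>2 / 2) * integral {t..t'} (\<lambda>s. D_y H s z)"
proof -
  have "\<exists>A. \<forall>z. - \<infinity> < ereal z \<longrightarrow> ereal z < \<infinity> \<longrightarrow> (A has_vector_derivative H 1 z - v) (at z)"
  proof (rule einterval_antiderivative)
    show "isCont (\<lambda>z. H 1 z - v) z" for z
      using DERIV_isCont[OF C12_D_y[OF H, of 1]] by (auto intro!: continuous_intros)
  qed simp
  then obtain A where A: "\<And>z. (A has_real_derivative H 1 z - v) (at z)"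
    by (auto simp: has_real_derivative_iff_has_vector_derivative)
  define G where "G = (\<lambda>t z. A z + \<sigma>\<^sup>2 / 2 * integral {t..1} (\<lambda>s. D_y H s z))"
  have k_cont: "continuous_on {t..t'} (\<lambda>s. D_y H s z)" if "0 \<le> t" "t' \<le> 1" for t t' z
    using that by (intro continuous_on_along_graph[OF C12_continuous(2)[OF H]] continuous_on_const) auto
  show thesis
  proof (rule that[of G])
    fix t z :: real assume t: "t \<in> {0..1}"
    have "((\<lambda>z. integral (cbox t 1) (\<lambda>s. D_y H s z)) has_field_derivative
        integral (cbox t 1) (\<lambda>s. D_yy H s z)) (at z within UNIV)"
    proof (rule leibniz_rule_field_derivative)
      show "((\<lambda>z. D_y H s z) has_field_derivative D_yy H s z) (at z within UNIV)" if "s \<in> cbox t 1" for z s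
        using C12_D_yy[OF H, of s z] that t by simp
      show "(\<lambda>s. D_y H s z) integrable_on cbox t 1" for z
        using k_cont[of t 1 z] t by (auto intro: integrable_continuous_real)
      have "continuous_on (UNIV \<times> cbox t 1) ((\<lambda>(s, z). D_yy H s z) \<circ> (\<lambda>(z, s). (s, z)))"
        using t by (intro continuous_on_compose continuous_on_subset[OF C12_continuous(3)[OF H]])
          (auto intro!: continuous_intros simp: case_prod_unfold)
      then show "continuous_on (UNIV \<times> cbox t 1) (\<lambda>(z, s). D_yy H s z)"
        by (simp add: comp_def case_prod_unfold)
    qed auto
    then have "(G t has_real_derivative (H 1 z - v) + \<sigma>\<^sup>2 / 2 * integral {t..1} (\<lambda>s. D_yy H s z)) (at z)"
      unfolding G_def by (intro DERIV_add A DERIV_cmult) simp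
    moreover have "(\<sigma>\<^sup>2 / 2) * integral {t..1} (\<lambda>s. D_yy H s z) = H t z - H 1 z"
    proof -
      have "((\<lambda>s. D_t H s z) has_integral (H 1 z - H t z)) {t..1}"
        using t by (intro fundamental_theorem_of_calculus has_vector_derivative_within_subset[OF C12_D_t[OF H]]) auto
      then have "((\<lambda>s. - (\<sigma>\<^sup>2 / 2) * D_yy H s z) has_integral (H 1 z - H t z)) {t..1}"
      proof (rule has_integral_eq[rotated])
        fix s assume "s \<in> {t..1}"
        then have "0 \<le> s" using t by auto
        from heat[OF this, of z] show "D_t H s z = - (\<sigma>\<^sup>2 / 2) * D_yy H s z" by simp
      qed
      then have "integral {t..1} (\<lambda>s. - (\<sigma>\<^sup>2 / 2) * D_yy H s z) = H 1 z - H t z"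
        by (rule integral_unique)
      then show ?thesis by (simp only: integral_mult_right)
    qed
    ultimately show "(G t has_real_derivative H t z - v) (at z)" by (simp add: algebra_simps)
  next
    fix t t' z :: real assume t: "0 \<le> t" "t \<le> t'" "t' \<le> 1"
    have "integral {t..t'} (\<lambda>s. D_y H s z) + integral {t'..1} (\<lambda>s. D_y H s z) = integral {t..1} (\<lambda>s. D_y H s z)"
      using t k_cont[of t 1 z]
      by (intro Henstock_Kurzweil_Integration.integral_combine integrable_continuous_real) auto
    then show "G t' z - G t z = - (\<sigma>\<^sup>2 / 2) * integral {t..t'} (\<lambda>s. D_y H s z)"
      unfolding G_def by (simp add: algebra_simps flip: distrib_left)
  qed
qed

lemma antiderivative_of_increasing_minimal:
  fixes A g :: "real \<Rightarrow> real"
  assumes A: "\<And>z. (A has_real_derivative g z - v) (at z)" and g: "mono g" and a: "g a = v"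
  shows "A a \<le> A z"
proof (cases "a \<le> z")
  case True
  have "0 \<le> g y - v" if "a \<le> y" for y using monoD[OF g that] a by simp
  then show ?thesis using A by (intro DERIV_nonneg_imp_nondecreasing[OF True]) blast
next
  case False
  show ?thesis
  proof (rule DERIV_nonpos_imp_nonincreasing[of z a A])
    show "z \<le> a" using False by simp
    fix y assume "y \<le> a"
    then have "g y - v \<le> 0" using monoD[OF g, of y a] a by simp
    then show "\<exists>d. (A has_real_derivative d) (at y) \<and> d \<le> 0" using A by blast
  qed
qed

section \<open>Extended expectations\<close>

text \<open>
  Wealth is compared through this with integrable random variables that agree with it, or dominate
  it, almost everywhere.
\<close>

lemma extended_expectation_mono:
  assumes "AE \<omega> in M. W \<omega> \<le> U \<omega>"
  shows "extended_expectation M W \<le> extended_expectation M U"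
proof -
  have "(\<integral>\<^sup>+\<omega>. ennreal (W \<omega>) \<partial>M) \<le> (\<integral>\<^sup>+\<omega>. ennreal (U \<omega>) \<partial>M)"
    using assms by (intro nn_integral_mono_AE) (auto elim!: eventually_mono intro: ennreal_leI)
  moreover have "(\<integral>\<^sup>+\<omega>. ennreal (- U \<omega>) \<partial>M) \<le> (\<integral>\<^sup>+\<omega>. ennreal (- W \<omega>) \<partial>M)"
    using assms by (intro nn_integral_mono_AE) (auto elim!: eventually_mono intro: ennreal_leI)
  ultimately show ?thesis
    unfolding extended_expectation_def by (intro ereal_minus_mono) (auto simp: less_eq_ennreal.rep_eq)
qed

lemma extended_expectation_integrable:
  assumes "integrable M U"
  shows "extended_expectation M U = ereal (\<integral>\<omega>. U \<omega> \<partial>M)"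
proof -
  have "(\<integral>\<^sup>+\<omega>. ennreal (U \<omega>) \<partial>M) \<noteq> \<infinity>" "(\<integral>\<^sup>+\<omega>. ennreal (- U \<omega>) \<partial>M) \<noteq> \<infinity>"
    using assms by (auto simp: real_integrable_def)
  then obtain p q where "0 \<le> p" "(\<integral>\<^sup>+\<omega>. ennreal (U \<omega>) \<partial>M) = ennreal p"
    "0 \<le> q" "(\<integral>\<^sup>+\<omega>. ennreal (- U \<omega>) \<partial>M) = ennreal q"
    by (metis ennreal_cases infinity_ennreal_def)
  then show ?thesis
    unfolding extended_expectation_def real_lebesgue_integral_def[OF assms]
    by (simp add: enn2ereal_ennreal)
qed

section \<open>Wealth in the market model\<close>

lemma sets_generated_filtration:
  "sets (generated_filtration \<Omega> V Z t) = sigma_sets \<Omega>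
     ({V -` A \<inter> \<Omega> | A. A \<in> sets borel} \<union> {Z s -` A \<inter> \<Omega> | s A. s \<in> {0..t} \<and> A \<in> sets borel})"
  unfolding generated_filtration_def by (intro sets_measure_of) auto

lemma space_generated_filtration: "space (generated_filtration \<Omega> V Z t) = \<Omega>"
  by (simp add: generated_filtration_def space_measure_of_conv)

lemma sets_generated_filtration_mono:
  "s \<le> t \<Longrightarrow> sets (generated_filtration \<Omega> V Z s) \<subseteq> sets (generated_filtration \<Omega> V Z t)"
  unfolding sets_generated_filtration by (intro sigma_sets_mono' Un_mono order_refl) fastforce

context insider_market
begin

context
  fixes v assumes v: "v \<in> range f"
begin

lemma Pv_space: "space (Pv v) = space P"
  and Pv_sets: "sets (Pv v) = sets (generated_filtration (space P) V B 1)"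
  and Pv_prob: "prob_space (Pv v)"
proof -
  have "Pv v \<in> space (prob_algebra (generated_filtration (space P) V B 1))"
    using v by (intro measurable_space[OF Pv_kernel]) (simp add: space_restrict_space)
  then have *: "sets (Pv v) = sets (generated_filtration (space P) V B 1)" "prob_space (Pv v)"
    by (simp_all add: space_prob_algebra)
  then show "sets (Pv v) = sets (generated_filtration (space P) V B 1)" "prob_space (Pv v)" by auto
  show "space (Pv v) = space P"
    using sets_eq_imp_space_eq[OF *(1)] by (simp add: space_generated_filtration)
qed

lemma brownian_filtration_generated:
  "brownian_filtration (Pv v) (generated_filtration (space (Pv v)) V B) B"
proof -
  have "unit_filtration (Pv v) (generated_filtration (space (Pv v)) V B)"
  proof
    show "subalgebra (Pv v) (generated_filtration (space (Pv v)) V B t)" if "t \<in> {0..1}" for t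
      using that sets_generated_filtration_mono[of t 1 "space P" V B]
      by (simp add: subalgebra_def space_generated_filtration Pv_sets Pv_space)
  qed (rule sets_generated_filtration_mono)
  then show ?thesis
    using bspec[OF Pv_brownian v] Pv_prob
    by (simp add: brownian_filtration_def brownian_filtration_axioms_def Pv_space)
qed

interpretation C: brownian_filtration "completion (Pv v)"
  "augmentation (Pv v) (generated_filtration (space (Pv v)) V B)" B
  by (rule brownian_filtration.brownian_filtration_augmentation[OF brownian_filtration_generated])

text \<open>
  Progressive measurability at time \<open>1\<close> makes the trading rate of each fixed path measurable in time,
  which together with its finite absolute integral makes it a Lebesgue density of the position.
\<close>

lemma strategy_density:
  assumes "insider_strategy \<sigma> f V B Pv H Z"
  obtains \<alpha> where "AE \<omega> in completion (Pv v). Z 0 \<omega> = 0 \<and> ac_density (\<lambda>t. Z t \<omega>) (\<lambda>t. \<alpha> t \<omega>)"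
proof -
  let ?I = "insider_filtration (Pv v) V H (total_demand \<sigma> B Z)"
  obtain \<alpha> where \<alpha>: "progressively_measurable ?I \<alpha>"
    and fin: "AE \<omega> in completion (Pv v). (\<integral>\<^sup>+s\<in>{0..1}. ennreal \<bar>\<alpha> s \<omega>\<bar> \<partial>lborel) < \<infinity>"
    and Z: "AE \<omega> in completion (Pv v). \<forall>t\<in>{0..1}. Z t \<omega> = (LINT s:{0..t}|lborel. \<alpha> s \<omega>)"
    using assms v unfolding insider_strategy_def by blast
  have "(\<lambda>(s, \<omega>). \<alpha> s \<omega>) \<in> borel_measurable (restrict_space borel {0..1} \<Otimes>\<^sub>M ?I 1)"
    using \<alpha> unfolding progressively_measurable_def by auto
  moreover have "space (?I 1) = space (Pv v)"
    by (simp add: insider_filtration_def augmentation_def space_measure_of_conv)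
  ultimately have slice: "(\<lambda>s. \<alpha> s \<omega>) \<in> borel_measurable (restrict_space borel {0..1})"
    if "\<omega> \<in> space (Pv v)" for \<omega>
    using measurable_compose[OF measurable_Pair2'] that by fastforce
  have "AE \<omega> in completion (Pv v). Z 0 \<omega> = 0 \<and> ac_density (\<lambda>t. Z t \<omega>) (\<lambda>t. \<alpha> t \<omega>)"
    using fin Z AE_space
  proof eventually_elim
    case (elim \<omega>)
    have "(\<lambda>s. indicator {0..1} s *\<^sub>R \<alpha> s \<omega>) \<in> borel_measurable borel"
      using slice[of \<omega>] elim(3) by (subst borel_measurable_restrict_space_iff[symmetric]) auto
    then have meas: "(\<lambda>s. indicator {0..1} s *\<^sub>R \<alpha> s \<omega>) \<in> borel_measurable lborel" by simp
    have "(\<integral>\<^sup>+s. ennreal (norm (indicator {0..1} s *\<^sub>R \<alpha> s \<omega>)) \<partial>lborel)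
        = (\<integral>\<^sup>+s\<in>{0..1}. ennreal \<bar>\<alpha> s \<omega>\<bar> \<partial>lborel)"
      by (intro nn_integral_cong) (auto simp: indicator_def)
    then have int: "set_integrable lborel {0..1} (\<lambda>s. \<alpha> s \<omega>)"
      unfolding set_integrable_def using elim(1) by (intro integrableI_bounded meas) (simp only:)
    have "(LINT s:{0..0}|lborel. \<alpha> s \<omega>) = 0"
    proof -
      have "AE s in lborel. indicator {0..0::real} s *\<^sub>R \<alpha> s \<omega> = 0"
        using AE_lborel_singleton[of 0] by eventually_elim (auto simp: indicator_def)
      then show ?thesis
        unfolding set_lebesgue_integral_def by (rule integral_eq_zero_AE)
    qed
    then have "Z 0 \<omega> = 0" using elim(2) by auto
    then show ?case using int elim(2) by (auto simp: ac_density_def)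
  qed
  then show ?thesis by (rule that)
qed

text \<open>
  The representation of wealth described at the beginning: \<open>Y\<^sub>0 = 0\<close> almost surely, and the wealth
  integral is the negative of the Lebesgue integral in Ito's formula once \<open>V\<close> is replaced by \<open>v\<close>.
\<close>

lemma wealth_decomposition:
  assumes H: "C12 H" and H_mono: "\<And>t. 0 \<le> t \<Longrightarrow> mono (H t)"
    and G_deriv: "\<And>t z. t \<in> {0..1} \<Longrightarrow> (G t has_real_derivative H t z - v) (at z)"
    and G_time: "\<And>t t' z. 0 \<le> t \<Longrightarrow> t \<le> t' \<Longrightarrow> t' \<le> 1 \<Longrightarrow>
        G t' z - G t z = - (\<sigma>\<^sup>2 / 2) * integral {t..t'} (\<lambda>s. D_y H s z)"
    and Z: "insider_strategy \<sigma> f V B Pv H Z"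
    and sq: "square_integrable_price \<sigma> B (Pv v) H Z"
  shows "\<exists>R. integrable (completion (Pv v)) R \<and> (\<integral>\<omega>. R \<omega> \<partial>completion (Pv v)) = 0 \<and>
    (AE \<omega> in completion (Pv v). wealth \<sigma> V B H Z \<omega> = G 0 0 - G 1 (Z 1 \<omega> + \<sigma> * B 1 \<omega>) + R \<omega>)"
proof -
  obtain \<alpha> where \<alpha>: "AE \<omega> in completion (Pv v). Z 0 \<omega> = 0 \<and> ac_density (\<lambda>t. Z t \<omega>) (\<lambda>t. \<alpha> t \<omega>)"
    using strategy_density[OF Z] by blast
  have Z_adapted: "Z t \<in> borel_measurable (augmentation (Pv v) (generated_filtration (space (Pv v)) V B) t)"
    if "t \<in> {0..1}" for t
    using Z v that unfolding insider_strategy_def by blast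
  have density: "AE \<omega> in completion (Pv v). ac_density (\<lambda>t. Z t \<omega>) (\<lambda>t. \<alpha> t \<omega>)"
    using \<alpha> by eventually_elim simp
  have fin: "(\<integral>\<^sup>+\<omega>. (\<integral>\<^sup>+t\<in>{0..1}. ennreal ((H t (Z t \<omega> + \<sigma> * B t \<omega>))\<^sup>2) \<partial>lborel) \<partial>completion (Pv v)) < \<infinity>"
    using sq by (simp add: square_integrable_price_def total_demand_def)
  obtain R where R: "integrable (completion (Pv v)) R" "(\<integral>\<omega>. R \<omega> \<partial>completion (Pv v)) = 0"
    and eq: "AE \<omega> in completion (Pv v). G 1 (Z 1 \<omega> + \<sigma> * B 1 \<omega>) - G 0 (Z 0 \<omega> + \<sigma> * B 0 \<omega>)
       - (LINT t:{0..1}|lborel. (H t (Z t \<omega> + \<sigma> * B t \<omega>) - v) * \<alpha> t \<omega>) = R \<omega>"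
    by (rule C.ito_martingale_part[OF C12_continuous(1,2)[OF H] _ _ G_deriv G_time Z_adapted density fin])
      (use H_mono C12_D_y[OF H] in auto)
  have V: "AE \<omega> in completion (Pv v). V \<omega> = v"
    using Pv_V v by (intro AE_completion) blast
  have "AE \<omega> in completion (Pv v). wealth \<sigma> V B H Z \<omega> = G 0 0 - G 1 (Z 1 \<omega> + \<sigma> * B 1 \<omega>) + R \<omega>"
    using \<alpha> eq V C.AE_B_0 C.AE_B_continuous
  proof eventually_elim
    case (elim \<omega>)
    have cont: "continuous_on {0..1} (\<lambda>s. V \<omega> - H s (total_demand \<sigma> B Z s \<omega>))"
      unfolding total_demand_def
      using elim(5) ac_density_continuous[OF conjunct2[OF elim(1)]]
      by (intro continuous_on_diff continuous_on_const order_refl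
          continuous_on_along_graph[OF C12_continuous(1)[OF H]] continuous_on_add continuous_on_mult)
    then have "set_borel_measurable borel {0..1} (\<lambda>s. V \<omega> - H s (total_demand \<sigma> B Z s \<omega>))"
      unfolding set_borel_measurable_def by (intro borel_measurable_continuous_on_indicator) auto
    with elim(1) have "wealth \<sigma> V B H Z \<omega> = (LINT s:{0..1}|lborel. (V \<omega> - H s (total_demand \<sigma> B Z s \<omega>)) * \<alpha> s \<omega>)"
      unfolding wealth_def by (intro ac_integral_eq) auto
    also have "\<dots> = (LINT s:{0..1}|lborel. - ((H s (Z s \<omega> + \<sigma> * B s \<omega>) - v) * \<alpha> s \<omega>))"
      using elim(3) by (simp add: total_demand_def algebra_simps)
    also have "\<dots> = - (LINT s:{0..1}|lborel. (H s (Z s \<omega> + \<sigma> * B s \<omega>) - v) * \<alpha> s \<omega>)"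
      by (simp add: set_lebesgue_integral_def)
    finally show ?case using elim(1,2,4) by simp
  qed
  with R show ?thesis by blast
qed

end

end

section \<open>Optimality\<close>

theorem proposition3p1:
  fixes \<sigma> :: real and f :: "real \<Rightarrow> real"
    and P :: "'a measure" and F :: "real \<Rightarrow> 'a measure"
    and \<eta> V :: "'a \<Rightarrow> real" and B :: "real \<Rightarrow> 'a \<Rightarrow> real"
    and Pv :: "real \<Rightarrow> 'a measure"
    and H :: "real \<Rightarrow> real \<Rightarrow> real" and X :: "real \<Rightarrow> 'a \<Rightarrow> real"
  assumes market: "insider_market \<sigma> f P F \<eta> V B Pv"
    and pricing: "pricing_rule \<sigma> P B H"
    and heat: "\<forall>t\<ge>0. \<forall>y. D_t H t y + \<sigma>\<^sup>2 / 2 * D_yy H t y = 0"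
    and strategy: "insider_strategy \<sigma> f V B Pv H X"
    and square_integrable: "\<forall>v\<in>range f. square_integrable_price \<sigma> B (Pv v) H X"
    and terminal: "\<forall>v\<in>range f. AE \<omega> in completion (Pv v). H 1 (X 1 \<omega> + \<sigma> * B 1 \<omega>) = V \<omega>"
  shows "X \<in> admissible \<sigma> f V B Pv H \<and>
    (\<forall>v\<in>range f.
       extended_expectation (completion (Pv v)) (wealth \<sigma> V B H X)
         = (SUP Z \<in> admissible \<sigma> f V B Pv H.
              extended_expectation (completion (Pv v)) (wealth \<sigma> V B H Z)))"
proof -
  interpret insider_market \<sigma> f P F \<eta> V B Pv by (rule market)
  have H: "C12 H" and H_strict: "\<And>t. 0 \<le> t \<Longrightarrow> strict_mono (H t)"
    using pricing by (auto simp: pricing_rule_def)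
  have H_mono: "mono (H t)" if "0 \<le> t" for t by (rule strict_mono_mono[OF H_strict[OF that]])
  \<comment> \<open>\<open>c\<close> is the optimal expected wealth \<open>G(0,0) - G(1,a)\<close> for the value \<open>v\<close>\<close>
  have bound: "\<exists>c R. integrable (completion (Pv v)) R
      \<and> (AE \<omega> in completion (Pv v). wealth \<sigma> V B H X \<omega> = R \<omega>)
      \<and> (\<integral>\<omega>. R \<omega> \<partial>completion (Pv v)) = c
      \<and> (\<forall>Z. insider_strategy \<sigma> f V B Pv H Z \<longrightarrow> square_integrable_price \<sigma> B (Pv v) H Z \<longrightarrow>
          extended_expectation (completion (Pv v)) (wealth \<sigma> V B H Z) \<le> ereal c)"
    if v: "v \<in> range f" for v
  proof -
    interpret M: prob_space "Pv v" by (rule Pv_prob[OF v])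
    interpret C: prob_space "completion (Pv v)" by (rule M.prob_space_completion)
    obtain G where G: "\<And>t z. t \<in> {0..1} \<Longrightarrow> (G t has_real_derivative H t z - v) (at z)"
      "\<And>t t' z. 0 \<le> t \<Longrightarrow> t \<le> t' \<Longrightarrow> t' \<le> 1 \<Longrightarrow>
        G t' z - G t z = - (\<sigma>\<^sup>2 / 2) * integral {t..t'} (\<lambda>s. D_y H s z)"
      using insider_potential_exists[OF H, of \<sigma> v] heat by blast
    have decomposition: "\<exists>R. integrable (completion (Pv v)) R \<and> C.expectation R = 0 \<and>
        (AE \<omega> in completion (Pv v). wealth \<sigma> V B H Z \<omega> = G 0 0 - G 1 (Z 1 \<omega> + \<sigma> * B 1 \<omega>) + R \<omega>)"
      if "insider_strategy \<sigma> f V B Pv H Z" "square_integrable_price \<sigma> B (Pv v) H Z" for Z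
      by (rule wealth_decomposition) (fact v H H_mono G that)+
    have "AE \<omega> in completion (Pv v). H 1 (X 1 \<omega> + \<sigma> * B 1 \<omega>) = v"
      using terminal[rule_format, OF v] AE_completion[OF Pv_V[rule_format, OF v]] by eventually_elim simp
    \<comment> \<open>the terminal condition holds almost surely, hence at some point of the probability space; there the final demand is a suitable \<open>a\<close>\<close>
    moreover obtain a where a: "H 1 a = v"
      using eventually_happens[OF calculation] C.AE_False by (auto simp: trivial_limit_def)
    moreover have "inj (H 1)" using H_strict[of 1] by (simp add: strict_mono_imp_inj_on)
    ultimately have end_X: "AE \<omega> in completion (Pv v). X 1 \<omega> + \<sigma> * B 1 \<omega> = a"
      by (auto elim!: eventually_mono dest: injD)
    have min: "G 1 a \<le> G 1 z" for z
      using G(1)[of 1] H_mono[of 1] a by (intro antiderivative_of_increasing_minimal[of _ "H 1" v]) auto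
    define c where "c = G 0 0 - G 1 a"
    obtain R where R: "integrable (completion (Pv v)) R" "C.expectation R = 0"
      "AE \<omega> in completion (Pv v). wealth \<sigma> V B H X \<omega> = G 0 0 - G 1 (X 1 \<omega> + \<sigma> * B 1 \<omega>) + R \<omega>"
      using decomposition[OF strategy square_integrable[rule_format, OF v]] by blast
    have "extended_expectation (completion (Pv v)) (wealth \<sigma> V B H Z) \<le> ereal c"
      if Z: "insider_strategy \<sigma> f V B Pv H Z" "square_integrable_price \<sigma> B (Pv v) H Z" for Z
    proof -
      obtain R where R: "integrable (completion (Pv v)) R" "C.expectation R = 0"
        "AE \<omega> in completion (Pv v). wealth \<sigma> V B H Z \<omega> = G 0 0 - G 1 (Z 1 \<omega> + \<sigma> * B 1 \<omega>) + R \<omega>"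
        using decomposition[OF Z] by blast
      have "AE \<omega> in completion (Pv v). wealth \<sigma> V B H Z \<omega> \<le> c + R \<omega>"
        using R(3)
      proof eventually_elim
        case (elim \<omega>)
        then show ?case using min[of "Z 1 \<omega> + \<sigma> * B 1 \<omega>"] by (simp add: c_def)
      qed
      then have "extended_expectation (completion (Pv v)) (wealth \<sigma> V B H Z)
          \<le> extended_expectation (completion (Pv v)) (\<lambda>\<omega>. c + R \<omega>)"
        by (rule extended_expectation_mono)
      also have "\<dots> = ereal c"
        using R by (simp add: extended_expectation_integrable M.prob_space)
      finally show ?thesis .
    qed
    moreover have "AE \<omega> in completion (Pv v). wealth \<sigma> V B H X \<omega> = c + R \<omega>"
      using R(3) end_X by eventually_elim (simp add: c_def)
    moreover have "integrable (completion (Pv v)) (\<lambda>\<omega>. c + R \<omega>)" "C.expectation (\<lambda>\<omega>. c + R \<omega>) = c"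
      using R by (simp_all add: M.prob_space)
    ultimately show ?thesis by blast
  qed
  have X: "X \<in> admissible \<sigma> f V B Pv H"
  proof -
    have "extended_expectation (completion (Pv v)) (\<lambda>\<omega>. min 0 (wealth \<sigma> V B H X \<omega>)) > -\<infinity>"
      if v: "v \<in> range f" for v
    proof -
      obtain R where R: "integrable (completion (Pv v)) R"
        "AE \<omega> in completion (Pv v). wealth \<sigma> V B H X \<omega> = R \<omega>" using bound[OF v] by blast
      have "integrable (completion (Pv v)) (\<lambda>\<omega>. min 0 (R \<omega>))" using R(1) by (intro integrable_min) auto
      then have "-\<infinity> < extended_expectation (completion (Pv v)) (\<lambda>\<omega>. min 0 (R \<omega>))"
        by (simp add: extended_expectation_integrable)
      also have "\<dots> \<le> extended_expectation (completion (Pv v)) (\<lambda>\<omega>. min 0 (wealth \<sigma> V B H X \<omega>))"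
        using R(2) by (intro extended_expectation_mono) (auto elim!: eventually_mono)
      finally show ?thesis .
    qed
    then show ?thesis using strategy square_integrable by (simp add: admissible_def)
  qed
  moreover have "extended_expectation (completion (Pv v)) (wealth \<sigma> V B H X)
         = (SUP Z \<in> admissible \<sigma> f V B Pv H.
              extended_expectation (completion (Pv v)) (wealth \<sigma> V B H Z))" if v: "v \<in> range f" for v
  proof (rule antisym)
    obtain c R where R: "integrable (completion (Pv v)) R" "AE \<omega> in completion (Pv v). wealth \<sigma> V B H X \<omega> = R \<omega>"
      "(\<integral>\<omega>. R \<omega> \<partial>completion (Pv v)) = c"
      and opt: "\<And>Z. insider_strategy \<sigma> f V B Pv H Z \<Longrightarrow> square_integrable_price \<sigma> B (Pv v) H Z \<Longrightarrow>
          extended_expectation (completion (Pv v)) (wealth \<sigma> V B H Z) \<le> ereal c"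
      using bound[OF v] by blast
    have "ereal c = extended_expectation (completion (Pv v)) R"
      using R by (simp add: extended_expectation_integrable)
    also have "\<dots> \<le> extended_expectation (completion (Pv v)) (wealth \<sigma> V B H X)"
      using R(2) by (intro extended_expectation_mono) (auto elim!: eventually_mono)
    finally show "(SUP Z \<in> admissible \<sigma> f V B Pv H.
        extended_expectation (completion (Pv v)) (wealth \<sigma> V B H Z))
      \<le> extended_expectation (completion (Pv v)) (wealth \<sigma> V B H X)"
      using opt v by (intro SUP_least) (auto simp: admissible_def intro: order_trans)
  qed (rule SUP_upper[OF X])
  ultimately show ?thesis by blast
qed

end
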